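(* Let $p>1$, $p'=p/(p-1)$, $s\in(0,1)$, let $\Omega\subset\mathbb{R}^N$ be an open bounded set, and $h\in L^{p'}(\Omega)\setminus\{0\}$. Let $u\in\widetilde{W}_0^{s,p}(\Omega)$ be the unique function such that $$\iint_{\mathbb{R}^{2N}}\frac{|u(x)-u(y)|^{p-2}(u(x)-u(y))(\xi(x)-\xi(y))}{|x-y|^{N+ps}}\,dxdy-\int_\Omega h\xi\,dx=0\quad\text{for any }\xi\in\widetilde{W}_0^{s,p}(\Omega).$$ Then for any $v\in\widetilde{W}_0^{s,p}(\Omega)$, $$[u-v]_p\le C\,\|F'(v)\|_*^{\frac{1}{\max\{1,p-1\}}}$$ and $$\|F'(v)\|_*\le\inf_{\gamma^*\in Q_s^*}\Bigl(\bigl(\mathcal{P}(|\nabla^{(s)}v|^{p-2}\nabla^{(s)}v-\gamma^* )\bigr)^{1/p'}+C_{F,s}\|\mathrm{div}^{(s)}\gamma^*-h\|_{p'}\Bigr),$$ where $$C=\begin{cases}2^{\frac{p-2}{p-1}},& p\ge2,\\ (p-1)^{-1}\,2^{\frac{2-p}{p}}\left(C_{F,s}^{p'}\|h\|_{p'}^{p'}+[v]_p^p\right)^{\frac{2-p}{p}},& p<2.\end{cases}$$ Moreover, if $\mathcal{L}_p^sv\in L^{p'}(\Omega)$, then $$\|F'(v)\|_*\le C_{F,s}\|\mathcal{L}_p^sv-h\|_{p'}.$$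
   Context: $\|\cdot\|_q$ is the norm of $L^q(\Omega)$; $|a|^{p-2}a:=0$ for $a=0$. The Gagliardo seminorm is $[u]_p^p=\iint_{\mathbb{R}^{2N}}\frac{|u(x)-u(y)|^p}{|x-y|^{N+ps}}\,dxdy$, $W^{s,p}(\mathbb{R}^N)=\{u\in L^p(\mathbb{R}^N):[u]_p<+\infty\}$, and $\widetilde{W}_0^{s,p}(\Omega)$ is the closure of $C_0^\infty(\Omega)$ with respect to $\|\cdot\|_{L^p(\mathbb{R}^N)}+[\,\cdot\,]_p$; on it $[\,\cdot\,]_p$ is an equivalent norm. $C_{F,s}$ is the (optimal) constant of the embedding $\widetilde{W}_0^{s,p}(\Omega)\subset L^p(\Omega)$, i.e. the best constant in $\|w\|_p\le C_{F,s}[w]_p$. For $v,\xi\in\widetilde{W}_0^{s,p}(\Omega)$, $$\langle F'(v),\xi\rangle=\iint_{\mathbb{R}^{2N}}\frac{|v(x)-v(y)|^{p-2}(v(x)-v(y))(\xi(x)-\xi(y))}{|x-y|^{N+ps}}\,dxdy-\int_\Omega h\xi\,dx,\qquad \|F'(v)\|_*=\sup_{\xi\in\widetilde{W}_0^{s,p}(\Omega)\setminus\{0\}}\frac{\langle F'(v),\xi\rangle}{[\xi]_p}.$$ For measurable $w:\mathbb{R}^N\to\mathbb{R}$ and $\gamma:\mathbb{R}^{2N}\to\mathbb{R}$, $$\nabla^{(s)}w(x,y)=\frac{w(x)-w(y)}{|x-y|^s},\qquad(\mathrm{div}^{(s)}\gamma)(x)=2\int_{\mathbb{R}^N}\gamma(x,y)\frac{dy}{|x-y|^{N+s}},$$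 $$\mathcal{L}_p^sw(x)=2\int_{\mathbb{R}^N}\frac{|w(x)-w(y)|^{p-2}(w(x)-w(y))}{|x-y|^{N+ps}}\,dy,\qquad\mathcal{P}(\gamma)=\iint_{\mathbb{R}^{2N}}|\gamma(x,y)|^{p'}\frac{dxdy}{|x-y|^N}$$ (integrals without principal value). Finally, $$Q_s^*=\{\gamma:\mathbb{R}^{2N}\to\mathbb{R}\ \text{measurable}:\ \gamma(x,y)=-\gamma(y,x),\ \mathrm{div}^{(s)}\gamma\in L^{p'}(\Omega),\ \mathcal{P}(\gamma)<\infty\}.$$
   Formalization: Membership of div^(s)γ and L_p^s v in L^{p'}(Ω) also requires their kernels to be absolutely integrable on K×R^N for all compact K⊂Ω; with mere a.e. convergence the second and third bounds fail (p=2, s<1/2, cut-off Riesz potential of a Cantor measure). *)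

theory Defs
  imports "HOL-Analysis.Analysis"
begin

text \<open>
  The space R^N is an arbitrary Euclidean space \<open>'a\<close> with \<open>N = DIM('a)\<close>, and R^2N is \<open>'a \<times> 'a\<close>.
  Elements of function spaces are represented by Lebesgue measurable functions, so that
  equality in these spaces means equality almost everywhere.
\<close>

definition in_Lp :: "'b measure \<Rightarrow> real \<Rightarrow> ('b \<Rightarrow> real) \<Rightarrow> bool" where
  "in_Lp M q f \<longleftrightarrow> f \<in> borel_measurable M \<and> integrable M (\<lambda>x. \<bar>f x\<bar> powr q)"

definition Lp_norm :: "'b measure \<Rightarrow> real \<Rightarrow> ('b \<Rightarrow> real) \<Rightarrow> real" where
  "Lp_norm M q f = (LINT x|M. \<bar>f x\<bar> powr q) powr (1 / q)"

text \<open>The map \<open>a \<mapsto> |a|^(p-2) a\<close>; it is \<open>0\<close> at \<open>a = 0\<close> for every \<open>p\<close>.\<close>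

definition sgn_powr :: "real \<Rightarrow> real \<Rightarrow> real" where
  "sgn_powr p a = \<bar>a\<bar> powr (p - 2) * a"

primrec Ck :: "nat \<Rightarrow> ('a::euclidean_space \<Rightarrow> real) \<Rightarrow> bool" where
  "Ck 0 f \<longleftrightarrow> continuous_on UNIV f"
| "Ck (Suc k) f \<longleftrightarrow>
     (\<forall>x. f differentiable (at x)) \<and> (\<forall>b\<in>Basis. Ck k (\<lambda>x. frechet_derivative f (at x) b))"

definition test_functions :: "'a::euclidean_space set \<Rightarrow> ('a \<Rightarrow> real) set" where
  "test_functions \<Omega> = {\<phi>. (\<forall>k. Ck k \<phi>) \<and> compact (closure {x. \<phi> x \<noteq> 0}) \<and>
     closure {x. \<phi> x \<noteq> 0} \<subseteq> \<Omega>}"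

text \<open>
  In all kernels below the diagonal \<open>x = y\<close>, a null set of \<open>'a \<times> 'a\<close>, contributes \<open>0\<close> because
  division by zero is zero.
\<close>

definition gagliardo_integrand :: "real \<Rightarrow> real \<Rightarrow> ('a::euclidean_space \<Rightarrow> real) \<Rightarrow> 'a \<times> 'a \<Rightarrow> real" where
  "gagliardo_integrand p s u =
     (\<lambda>(x, y). \<bar>u x - u y\<bar> powr p / norm (x - y) powr (real DIM('a) + p * s))"

definition gagliardo :: "real \<Rightarrow> real \<Rightarrow> ('a::euclidean_space \<Rightarrow> real) \<Rightarrow> real" where
  "gagliardo p s u = (LINT z|lebesgue. gagliardo_integrand p s u z) powr (1 / p)"

definition Wsp :: "real \<Rightarrow> real \<Rightarrow> ('a::euclidean_space \<Rightarrow> real) set" where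
  "Wsp p s = {u. in_Lp lebesgue p u \<and> integrable lebesgue (gagliardo_integrand p s u)}"

definition W0 :: "real \<Rightarrow> real \<Rightarrow> 'a::euclidean_space set \<Rightarrow> ('a \<Rightarrow> real) set" where
  "W0 p s \<Omega> = {u \<in> Wsp p s. \<forall>\<epsilon>>0. \<exists>\<phi>\<in>test_functions \<Omega>.
     Lp_norm lebesgue p (\<lambda>x. u x - \<phi> x) + gagliardo p s (\<lambda>x. u x - \<phi> x) < \<epsilon>}"

definition CF :: "real \<Rightarrow> real \<Rightarrow> 'a::euclidean_space set \<Rightarrow> real" where
  "CF p s \<Omega> = Inf {C. 0 \<le> C \<and> (\<forall>w\<in>W0 p s \<Omega>. Lp_norm (lebesgue_on \<Omega>) p w \<le> C * gagliardo p s w)}"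

definition dF ::
  "real \<Rightarrow> real \<Rightarrow> 'a::euclidean_space set \<Rightarrow> ('a \<Rightarrow> real) \<Rightarrow> ('a \<Rightarrow> real) \<Rightarrow> ('a \<Rightarrow> real) \<Rightarrow> real" where
  "dF p s \<Omega> h v \<xi> =
     (LINT z|lebesgue. (case z of (x, y) \<Rightarrow>
        sgn_powr p (v x - v y) * (\<xi> x - \<xi> y) / norm (x - y) powr (real DIM('a) + p * s)))
     - (LINT x|lebesgue_on \<Omega>. h x * \<xi> x)"

definition dF_dual_norm ::
  "real \<Rightarrow> real \<Rightarrow> 'a::euclidean_space set \<Rightarrow> ('a \<Rightarrow> real) \<Rightarrow> ('a \<Rightarrow> real) \<Rightarrow> real" where
  "dF_dual_norm p s \<Omega> h v =
     (SUP \<xi> \<in> {\<xi> \<in> W0 p s \<Omega>. \<not> (AE x in lebesgue. \<xi> x = 0)}. dF p s \<Omega> h v \<xi> / gagliardo p s \<xi>)"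

definition frac_grad :: "real \<Rightarrow> ('a::euclidean_space \<Rightarrow> real) \<Rightarrow> 'a \<times> 'a \<Rightarrow> real" where
  "frac_grad s w = (\<lambda>(x, y). (w x - w y) / norm (x - y) powr s)"

definition frac_div_kernel :: "real \<Rightarrow> ('a::euclidean_space \<times> 'a \<Rightarrow> real) \<Rightarrow> 'a \<times> 'a \<Rightarrow> real" where
  "frac_div_kernel s \<gamma> = (\<lambda>(x, y). \<gamma> (x, y) / norm (x - y) powr (real DIM('a) + s))"

definition frac_div :: "real \<Rightarrow> ('a::euclidean_space \<times> 'a \<Rightarrow> real) \<Rightarrow> 'a \<Rightarrow> real" where
  "frac_div s \<gamma> x = 2 * (LINT y|lebesgue. frac_div_kernel s \<gamma> (x, y))"

definition frac_plap_kernel :: "real \<Rightarrow> real \<Rightarrow> ('a::euclidean_space \<Rightarrow> real) \<Rightarrow> 'a \<times> 'a \<Rightarrow> real" where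
  "frac_plap_kernel p s w = (\<lambda>(x, y). sgn_powr p (w x - w y) / norm (x - y) powr (real DIM('a) + p * s))"

definition frac_plap :: "real \<Rightarrow> real \<Rightarrow> ('a::euclidean_space \<Rightarrow> real) \<Rightarrow> 'a \<Rightarrow> real" where
  "frac_plap p s w x = 2 * (LINT y|lebesgue. frac_plap_kernel p s w (x, y))"

text \<open>
  The integrals defining \<open>frac_div\<close> and \<open>frac_plap\<close> are taken without principal value, but the
  Bochner integral is \<open>0\<close> where the kernel is not integrable in \<open>y\<close>. A statement that they lie in a
  space of functions on \<open>\<Omega>\<close> therefore includes the absolute convergence below: the kernel is
  integrable on \<open>K \<times> R^N\<close> for compact \<open>K \<subseteq> \<Omega>\<close>, i.e. the integral of its absolute value over \<open>y\<close>
  is a locally integrable function of \<open>x \<in> \<Omega>\<close>. Absolute convergence for almost every single \<open>x\<close> is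
  not enough: \<open>w\<close> may be the Riesz potential of a singular measure on a closed null set, smooth
  outside that set, and then the pointwise integral misses the singular part of the
  distributional operator.
\<close>

definition locally_convergent :: "'a::euclidean_space set \<Rightarrow> ('a \<times> 'a \<Rightarrow> real) \<Rightarrow> bool" where
  "locally_convergent \<Omega> k \<longleftrightarrow>
     (\<forall>K. compact K \<and> K \<subseteq> \<Omega> \<longrightarrow> set_integrable lebesgue (K \<times> UNIV) k)"

definition frac_div_in_Lp :: "real \<Rightarrow> 'a::euclidean_space set \<Rightarrow> real \<Rightarrow> ('a \<times> 'a \<Rightarrow> real) \<Rightarrow> bool" where
  "frac_div_in_Lp s \<Omega> q \<gamma> \<longleftrightarrow>
     locally_convergent \<Omega> (frac_div_kernel s \<gamma>) \<and> in_Lp (lebesgue_on \<Omega>) q (frac_div s \<gamma>)"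

definition frac_plap_in_Lp :: "real \<Rightarrow> real \<Rightarrow> 'a::euclidean_space set \<Rightarrow> real \<Rightarrow> ('a \<Rightarrow> real) \<Rightarrow> bool" where
  "frac_plap_in_Lp p s \<Omega> q w \<longleftrightarrow>
     locally_convergent \<Omega> (frac_plap_kernel p s w) \<and> in_Lp (lebesgue_on \<Omega>) q (frac_plap p s w)"

definition P_integrand :: "real \<Rightarrow> ('a::euclidean_space \<times> 'a \<Rightarrow> real) \<Rightarrow> 'a \<times> 'a \<Rightarrow> real" where
  "P_integrand q \<gamma> = (\<lambda>(x, y). \<bar>\<gamma> (x, y)\<bar> powr q / norm (x - y) powr real DIM('a))"

text \<open>The argument \<open>q\<close> of \<open>P_fun\<close> and \<open>Qs\<close> is the conjugate exponent \<open>p'\<close>.\<close>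

definition P_fun :: "real \<Rightarrow> ('a::euclidean_space \<times> 'a \<Rightarrow> real) \<Rightarrow> real" where
  "P_fun q \<gamma> = (LINT z|lebesgue. P_integrand q \<gamma> z)"

definition Qs :: "real \<Rightarrow> 'a::euclidean_space set \<Rightarrow> real \<Rightarrow> ('a \<times> 'a \<Rightarrow> real) set" where
  "Qs s \<Omega> q = {\<gamma> \<in> borel_measurable lebesgue. (\<forall>x y. \<gamma> (x, y) = - \<gamma> (y, x)) \<and>
     frac_div_in_Lp s \<Omega> q \<gamma> \<and> integrable lebesgue (P_integrand q \<gamma>)}"

end

(* Put D w (x, y) = (w x - w y) / |x - y|^(N/p + s). Then [w]_p is the L^p norm of D w and the nonlinear
   part of F'(v) at xi is the integral of |D v|^(p-2) D v times D xi, so everything takes place in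
   L^p and L^p' of the product space. The first estimate is the strong monotonicity of
   a -> |a|^(p-2) a (for p < 2 combined with Hoelder's inequality), tested with v - u. For the second
   one, let G = gamma / |x - y|^(N/p'): add and subtract the integral of G times D xi, which equals the
   integral of div gamma times xi over Omega. For test functions xi this is Fubini's theorem and
   the antisymmetry of gamma; density gives all xi. Hoelder's inequality and the fractional Poincare
   inequality conclude. The last estimate is the choice gamma = |grad v|^(p-2) grad v. *)

theory Submission
  imports Defs
begin

section \<open>Monotonicity of the power map\<close>

text \<open>Suprema and infima are taken in the reals, so each one carries an obligation.
  \<open>CF\<close> needs some admissible constant; a ball outside \<Omega>, on which every element
  of \<open>W0\<close> vanishes, provides it. The dual norm needs a competitor, a bump function
  inside \<Omega> (nonempty because \<open>h\<close> is not null), and an upper bound, which is the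
  second estimate at gamma = 0. Density is usable only once test functions are known to have finite
  seminorm, that is, once the kernel is integrable near the diagonal and at infinity. The constants:
  2^(p-2) is the inverse of the best factor in the monotonicity inequality for p >= 2, and its root
  of order p-1 appears in \<open>C\<close>. For p < 2 the factor p-1 is that of the derivative of
  t^(p-1), Hoelder's inequality leaves [u]^p + [v]^p, and the unknown [u]^p is bounded by the data
  on testing the equation with \<open>u\<close>.\<close>

lemma Young_powr:
  fixes a b \<theta> :: real
  assumes "0 \<le> a" "0 \<le> b" "0 < \<theta>" "\<theta> < 1"
  shows "a powr \<theta> * b powr (1 - \<theta>) \<le> \<theta> * a + (1 - \<theta>) * b"
  using Youngs_inequality_0[of \<theta> "1 - \<theta>" a b] assms by (cases "a = 0 \<or> b = 0") auto

lemma sgn_powr_pos: "0 \<le> a \<Longrightarrow> sgn_powr p a = a powr (p - 1)"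
  by (cases "a = 0") (simp_all add: sgn_powr_def powr_diff powr_numeral power2_eq_square)

lemma sgn_powr_minus: "sgn_powr p (- a) = - sgn_powr p a"
  by (simp add: sgn_powr_def)

lemma abs_sgn_powr: "\<bar>sgn_powr p a\<bar> = \<bar>a\<bar> powr (p - 1)"
  using sgn_powr_pos[of "\<bar>a\<bar>" p] by (simp add: sgn_powr_def abs_mult)

lemma sgn_powr_mult_self: "sgn_powr p a * a = \<bar>a\<bar> powr p"
  by (cases "a = 0") (simp_all add: sgn_powr_def powr_diff powr_numeral power2_eq_square field_simps)

lemma sgn_powr_divide_pos: "0 < c \<Longrightarrow> sgn_powr p (a / c) = sgn_powr p a / c powr (p - 1)"
  by (simp add: sgn_powr_def powr_divide powr_diff powr_numeral power2_eq_square)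

text \<open>Reduction of the monotonicity inequalities to a comparison of two numbers of equal sign and
  of two numbers of opposite sign.\<close>

lemma sgn_powr_pair_induct [case_names sym neg same opp]:
  fixes a b :: real
  assumes "\<And>a b. P a b \<Longrightarrow> P b a" "\<And>a b. P a b \<Longrightarrow> P (- a) (- b)"
    and "\<And>a b. 0 \<le> b \<Longrightarrow> b \<le> a \<Longrightarrow> P a b" "\<And>a c. 0 \<le> c \<Longrightarrow> c \<le> a \<Longrightarrow> P a (- c)"
  shows "P a b"
proof -
  have *: "P a b" if "\<bar>b\<bar> \<le> a" for a b
    using that assms(3)[of b a] assms(4)[of "- b" a] by (cases "0 \<le> b") auto
  \<comment> \<open>A swap makes the argument of larger absolute value the first one, and a sign
    change makes it nonnegative.\<close>
  have "\<bar>b\<bar> \<le> a \<or> \<bar>a\<bar> \<le> b \<or> \<bar>- b\<bar> \<le> - a \<or> \<bar>- a\<bar> \<le> - b" by linarith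
  then show ?thesis
    using *[of b a] *[of a b] *[of "- b" "- a"] *[of "- a" "- b"] assms(1)[of b a]
      assms(1)[of "- b" "- a"] assms(2)[of "- a" "- b"] by auto
qed

text \<open>Midpoint convexity of t^r for positive arguments; if one argument vanishes,
  \<open>2 powr (1 - r) \<le> 1\<close> is enough.\<close>

lemma powr_add_convex:
  fixes a c r :: real
  assumes "1 \<le> r" "0 \<le> a" "0 \<le> c"
  shows "2 powr (1 - r) * (a + c) powr r \<le> a powr r + c powr r"
proof (cases "a = 0 \<or> c = 0")
  case True
  have "2 powr (1 - r) \<le> 1" using powr_mono[of "1 - r" 0 "2::real"] assms by simp
  with True show ?thesis using mult_right_mono[of "2 powr (1 - r)" 1 "(a + c) powr r"] assms by auto
next
  case False
  have "((1 - 1/2) * a + (1/2) * c) powr r \<le> (1 - 1/2) * a powr r + (1/2) * c powr r"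
    using convex_onD[OF powr_convex[OF assms(1)], of "1/2" a c] False assms by simp
  moreover have "(1 - 1/2) * a + (1/2) * c = (a + c) / 2" by simp
  ultimately show ?thesis using assms
    by (simp add: powr_divide powr_diff field_simps)
qed

text \<open>For 0 <= t <= a one has t^r = t * t^(r-1) <= t * a^(r-1). Adding this for t = a - b and
  t = b gives a^r on the right.\<close>

lemma powr_superadd:
  fixes a b r :: real
  assumes "1 \<le> r" "0 \<le> b" "b \<le> a"
  shows "(a - b) powr r \<le> a powr r - b powr r"
proof (cases "a = 0")
  case False
  then have a: "0 < a" using assms by simp
  have *: "t powr r \<le> t * a powr (r - 1)" if "0 \<le> t" "t \<le> a" for t
  proof (cases "t = 0")
    case False
    have "t powr r = t * t powr (r - 1)" using False that by (simp add: powr_diff)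
    also have "\<dots> \<le> t * a powr (r - 1)" using that assms by (intro mult_left_mono powr_mono2) auto
    finally show ?thesis .
  qed auto
  have "(a - b) powr r + b powr r \<le> (a - b) * a powr (r - 1) + b * a powr (r - 1)"
    using *[of "a - b"] *[of b] assms by auto
  also have "\<dots> = a powr r" using a by (simp add: powr_diff field_simps)
  finally show ?thesis by simp
qed (use assms in auto)

text \<open>Opposite signs determine the constant: midpoint convexity gives
  \<open>2 powr (2 - p)\<close>, with equality at b = -a. For equal signs superadditivity gives the
  factor 1, which is larger.\<close>

lemma sgn_powr_mono_ge2:
  fixes a b p :: real
  assumes "2 \<le> p"
  shows "2 powr (2 - p) * \<bar>a - b\<bar> powr p \<le> (sgn_powr p a - sgn_powr p b) * (a - b)"
proof (induction a b rule: sgn_powr_pair_induct)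
  case (sym a b) then show ?case by (simp add: abs_minus_commute algebra_simps)
next
  case (neg a b) then show ?case by (simp add: sgn_powr_minus abs_minus_commute algebra_simps)
next
  case (same a b)
  have "2 powr (2 - p) * (a - b) powr (p - 1) \<le> 1 * (a - b) powr (p - 1)"
    using powr_mono[of "2 - p" 0 "2::real"] assms by (intro mult_right_mono) auto
  also have "\<dots> \<le> a powr (p - 1) - b powr (p - 1)" using powr_superadd[of "p - 1" b a] same assms by simp
  finally have "2 powr (2 - p) * (a - b) powr (p - 1) * (a - b) \<le> (a powr (p - 1) - b powr (p - 1)) * (a - b)"
    using same by (intro mult_right_mono) auto
  then show ?case using same sgn_powr_mult_self[of p "a - b"] by (simp add: sgn_powr_pos mult.assoc)
next
  case (opp a c)
  have "2 powr (2 - p) * (a + c) powr (p - 1) \<le> a powr (p - 1) + c powr (p - 1)"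
    using powr_add_convex[of "p - 1" a c] opp assms by simp
  then have "2 powr (2 - p) * (a + c) powr (p - 1) * (a + c) \<le> (a powr (p - 1) + c powr (p - 1)) * (a + c)"
    using opp by (intro mult_right_mono) auto
  then show ?case using opp sgn_powr_mult_self[of p "a + c"] by (simp add: sgn_powr_pos sgn_powr_minus mult.assoc)
qed

text \<open>Let a be the larger number. For equal signs the weighted inequality b^(p-1) a^(2-p) <=
  (p-1) b + (2-p) a rearranges to (p-1)(a-b) <= (a^(p-1) - b^(p-1)) a^(2-p); for opposite signs even
  the factor 1 holds. The natural weight a^(2-p) is enlarged to a power of |a|^p + |b|^p because the
  latter has an integral expressed by norms.\<close>

lemma sgn_powr_mono_lt2:
  fixes a b p :: real
  assumes "1 < p" "p < 2"
  shows "(p - 1) * (a - b)\<^sup>2 \<le>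
    (sgn_powr p a - sgn_powr p b) * (a - b) * (\<bar>a\<bar> powr p + \<bar>b\<bar> powr p) powr ((2 - p) / p)"
proof (induction a b rule: sgn_powr_pair_induct)
  case (sym a b) then show ?case by (simp add: power2_commute add.commute algebra_simps)
next
  case (neg a b) then show ?case by (simp add: sgn_powr_minus power2_commute algebra_simps)
next
  case (same a b)
  show ?case
  proof (cases "a = 0")
    case False
    then have a: "0 < a" using same by simp
    have "b powr (p - 1) * a powr (1 - (p - 1)) \<le> (p - 1) * b + (1 - (p - 1)) * a"
      using Young_powr[of b a "p - 1"] same assms by auto
    moreover have "a powr (p - 1) * a powr (1 - (p - 1)) = a" using a by (simp flip: powr_add)
    ultimately have "(p - 1) * (a - b) \<le> (a powr (p - 1) - b powr (p - 1)) * a powr (2 - p)"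
      by (simp add: algebra_simps)
    also have "\<dots> \<le> (a powr (p - 1) - b powr (p - 1)) * (a powr p + b powr p) powr ((2 - p) / p)"
    proof (intro mult_left_mono)
      have "a powr (2 - p) = (a powr p) powr ((2 - p) / p)" using assms by (simp add: powr_powr)
      also have "\<dots> \<le> (a powr p + b powr p) powr ((2 - p) / p)" using assms by (intro powr_mono2) auto
      finally show "a powr (2 - p) \<le> (a powr p + b powr p) powr ((2 - p) / p)" .
      show "0 \<le> a powr (p - 1) - b powr (p - 1)" using same assms by (simp add: powr_mono2)
    qed
    finally have "(p - 1) * (a - b) * (a - b) \<le>
        (a powr (p - 1) - b powr (p - 1)) * (a powr p + b powr p) powr ((2 - p) / p) * (a - b)"
      using same by (intro mult_right_mono) auto
    then show ?thesis using same by (simp add: sgn_powr_pos power2_eq_square mult.assoc mult.left_commute mult.commute)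
  qed (use same in auto)
next
  case (opp a c)
  show ?case
  proof (cases "a = 0")
    case False
    then have a: "0 < a" using opp by simp
    have c: "c \<le> c powr (p - 1) * a powr (2 - p)"
    proof (cases "c = 0")
      case False
      then have "c = c powr (p - 1) * c powr (2 - p)" using opp by (simp flip: powr_add)
      also have "\<dots> \<le> c powr (p - 1) * a powr (2 - p)" using opp assms
        by (intro mult_left_mono powr_mono2) auto
      finally show ?thesis .
    qed auto
    have "(p - 1) * (a + c) \<le> 1 * (a + c)" using opp assms by (intro mult_right_mono) auto
    also have "\<dots> \<le> (a powr (p - 1) + c powr (p - 1)) * a powr (2 - p)"
      using c a by (simp add: algebra_simps flip: powr_add)
    also have "\<dots> \<le> (a powr (p - 1) + c powr (p - 1)) * (a powr p + c powr p) powr ((2 - p) / p)"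
    proof (intro mult_left_mono)
      have "a powr (2 - p) = (a powr p) powr ((2 - p) / p)" using assms by (simp add: powr_powr)
      also have "\<dots> \<le> (a powr p + c powr p) powr ((2 - p) / p)" using assms by (intro powr_mono2) auto
      finally show "a powr (2 - p) \<le> (a powr p + c powr p) powr ((2 - p) / p)" .
    qed auto
    finally have "(p - 1) * (a + c) * (a + c) \<le>
        (a powr (p - 1) + c powr (p - 1)) * (a powr p + c powr p) powr ((2 - p) / p) * (a + c)"
      using opp by (intro mult_right_mono) auto
    then show ?thesis using opp by (simp add: sgn_powr_pos sgn_powr_minus power2_eq_square mult.assoc mult.left_commute mult.commute)
  qed (use opp in auto)
qed

section \<open>Lebesgue spaces\<close>

lemma powr_le_powr_cancel:
  fixes x y a :: real
  assumes "x powr a \<le> y powr a" "0 < a" "0 \<le> y"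
  shows "x \<le> y"
  using powr_less_mono2[of a y x] assms by (meson not_le)

lemma in_Lp_integrable: "in_Lp M q f \<Longrightarrow> integrable M (\<lambda>x. \<bar>f x\<bar> powr q)"
  by (auto simp: in_Lp_def)

lemma Lp_norm_nonneg: "0 \<le> Lp_norm M q f"
  by (simp add: Lp_norm_def)

lemma integral_powr_nonneg: "0 \<le> (LINT x|M. \<bar>f x\<bar> powr q)" for f :: "'a \<Rightarrow> real"
  by simp

lemma Lp_norm_powr: "q \<noteq> 0 \<Longrightarrow> Lp_norm M q f powr q = (LINT x|M. \<bar>f x\<bar> powr q)"
  using integral_powr_nonneg[of M f q] by (simp add: Lp_norm_def powr_powr)

lemma Lp_norm_minus_commute: "Lp_norm M q (\<lambda>x. f x - g x) = Lp_norm M q (\<lambda>x. g x - f x)"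
  by (simp add: Lp_norm_def abs_minus_commute)

lemma abs_add_powr_le:
  fixes a b q :: real
  assumes "0 < q"
  shows "\<bar>a + b\<bar> powr q \<le> 2 powr q * (\<bar>a\<bar> powr q + \<bar>b\<bar> powr q)"
proof -
  have "\<bar>a + b\<bar> powr q \<le> (2 * max \<bar>a\<bar> \<bar>b\<bar>) powr q" using assms by (intro powr_mono2) auto
  also have "\<dots> = 2 powr q * max \<bar>a\<bar> \<bar>b\<bar> powr q" by (simp add: powr_mult)
  also have "\<dots> \<le> 2 powr q * (\<bar>a\<bar> powr q + \<bar>b\<bar> powr q)"
    by (intro mult_left_mono) (auto simp: max_def)
  finally show ?thesis .
qed

lemma in_Lp_add:
  assumes "in_Lp M q f" "in_Lp M q g" "0 < q"
  shows "in_Lp M q (\<lambda>x. f x + g x)"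
  unfolding in_Lp_def
proof
  have [measurable]: "f \<in> borel_measurable M" "g \<in> borel_measurable M" using assms by (auto simp: in_Lp_def)
  show "(\<lambda>x. f x + g x) \<in> borel_measurable M" by simp
  have "integrable M (\<lambda>x. 2 powr q * (\<bar>f x\<bar> powr q + \<bar>g x\<bar> powr q))"
    using assms by (auto simp: in_Lp_def)
  then show "integrable M (\<lambda>x. \<bar>f x + g x\<bar> powr q)"
    by (rule Bochner_Integration.integrable_bound) (use assms abs_add_powr_le in auto)
qed

lemma in_Lp_uminus: "in_Lp M q f \<Longrightarrow> in_Lp M q (\<lambda>x. - f x)"
  by (auto simp: in_Lp_def)

lemma in_Lp_diff:
  assumes "in_Lp M q f" "in_Lp M q g" "0 < q"
  shows "in_Lp M q (\<lambda>x. f x - g x)"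
  using in_Lp_add[OF assms(1) in_Lp_uminus[OF assms(2)] assms(3)] by simp

text \<open>Stands in for Minkowski's inequality: it only has to make sums of small functions small.
  One factor 2 comes from |a+b| <= 2 max(|a|,|b|), the other from 2 <= 2^q.\<close>

lemma Lp_norm_add_quasi:
  assumes "in_Lp M q f" "in_Lp M q g" "1 \<le> q"
  shows "Lp_norm M q (\<lambda>x. f x + g x) \<le> 4 * (Lp_norm M q f + Lp_norm M q g)"
proof -
  define m where "m = max (Lp_norm M q f) (Lp_norm M q g)"
  have m: "0 \<le> m" by (simp add: m_def Lp_norm_nonneg le_max_iff_disj)
  have 1: "integrable M (\<lambda>x. 2 powr q * (\<bar>f x\<bar> powr q + \<bar>g x\<bar> powr q))"
    using assms by (auto simp: in_Lp_def)
  have 2: "integrable M (\<lambda>x. \<bar>f x + g x\<bar> powr q)"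
    using in_Lp_add[OF assms(1,2)] assms by (simp add: in_Lp_def)
  have "Lp_norm M q (\<lambda>x. f x + g x) powr q = (LINT x|M. \<bar>f x + g x\<bar> powr q)"
    using assms by (simp add: Lp_norm_powr)
  also have "\<dots> \<le> (LINT x|M. 2 powr q * (\<bar>f x\<bar> powr q + \<bar>g x\<bar> powr q))"
    using assms by (intro integral_mono 1 2 abs_add_powr_le) auto
  also have "\<dots> = 2 powr q * (Lp_norm M q f powr q + Lp_norm M q g powr q)"
    using assms by (simp add: Lp_norm_powr in_Lp_def)
  also have "\<dots> \<le> 2 powr q * (m powr q + m powr q)"
    using assms by (intro mult_left_mono add_mono powr_mono2) (auto simp: m_def Lp_norm_nonneg)
  also have "\<dots> = 2 powr 1 * (2 powr q * m powr q)" by simp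
  also have "\<dots> \<le> 2 powr q * (2 powr q * m powr q)"
    using assms by (intro mult_right_mono powr_mono) auto
  also have "\<dots> = (4 * m) powr q" using powr_mult[of 2 2 q] by (simp add: powr_mult)
  finally have "Lp_norm M q (\<lambda>x. f x + g x) \<le> 4 * m"
    by (rule powr_le_powr_cancel) (use assms m in auto)
  also have "\<dots> \<le> 4 * (Lp_norm M q f + Lp_norm M q g)"
    using Lp_norm_nonneg[of M q f] Lp_norm_nonneg[of M q g] by (simp add: m_def)
  finally show ?thesis .
qed

text \<open>Young's inequality applied to the two functions divided by their integrals.\<close>

lemma Holder_powr:
  fixes A B :: "'a \<Rightarrow> real"
  assumes A: "integrable M A" "\<And>x. 0 \<le> A x" and B: "integrable M B" "\<And>x. 0 \<le> B x"
    and \<theta>: "0 < \<theta>" "\<theta> < 1"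
  shows "integrable M (\<lambda>x. A x powr \<theta> * B x powr (1 - \<theta>))"
    and "(LINT x|M. A x powr \<theta> * B x powr (1 - \<theta>)) \<le> (LINT x|M. A x) powr \<theta> * (LINT x|M. B x) powr (1 - \<theta>)"
proof -
  have [measurable]: "A \<in> borel_measurable M" "B \<in> borel_measurable M" using A B by auto
  have "integrable M (\<lambda>x. \<theta> * A x + (1 - \<theta>) * B x)" using A B by auto
  then show int: "integrable M (\<lambda>x. A x powr \<theta> * B x powr (1 - \<theta>))"
  proof (rule Bochner_Integration.integrable_bound)
    show "AE x in M. norm (A x powr \<theta> * B x powr (1 - \<theta>)) \<le> norm (\<theta> * A x + (1 - \<theta>) * B x)"
      using Young_powr[OF A(2) B(2) \<theta>] A(2) B(2) \<theta> by (intro AE_I2) simp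
  qed simp
  define a b where "a = (LINT x|M. A x)" and "b = (LINT x|M. B x)"
  have ab: "0 \<le> a" "0 \<le> b" using A(2) B(2) by (simp_all add: a_def b_def)
  show "(LINT x|M. A x powr \<theta> * B x powr (1 - \<theta>)) \<le> (LINT x|M. A x) powr \<theta> * (LINT x|M. B x) powr (1 - \<theta>)"
  proof (cases "a = 0 \<or> b = 0")
    \<comment> \<open>Normalising by \<open>a\<close> and \<open>b\<close> is impossible here, but a
      nonnegative function with integral 0 vanishes almost everywhere, and then so does the
      product.\<close>
    case True
    then have "(AE x in M. A x = 0) \<or> (AE x in M. B x = 0)"
      using integral_nonneg_eq_0_iff_AE[OF A(1)] integral_nonneg_eq_0_iff_AE[OF B(1)] A(2) B(2)
      unfolding a_def b_def by simp
    then have "AE x in M. A x powr \<theta> * B x powr (1 - \<theta>) = 0"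
    proof
      assume "AE x in M. A x = 0" then show ?thesis by eventually_elim simp
    next
      assume "AE x in M. B x = 0" then show ?thesis by eventually_elim simp
    qed
    then have "(LINT x|M. A x powr \<theta> * B x powr (1 - \<theta>)) = 0"
      by (rule integral_eq_zero_AE)
    then show ?thesis by simp
  next
    case False
    then have ab': "0 < a" "0 < b" using ab by auto
    have "A x powr \<theta> * B x powr (1 - \<theta>) \<le> a powr \<theta> * b powr (1 - \<theta>) * (\<theta> / a * A x + (1 - \<theta>) / b * B x)" for x
    proof -
      have "(A x / a) powr \<theta> * (B x / b) powr (1 - \<theta>) \<le> \<theta> * (A x / a) + (1 - \<theta>) * (B x / b)"
        using A(2)[of x] B(2)[of x] ab' \<theta> by (intro Young_powr) auto
      then have "a powr \<theta> * b powr (1 - \<theta>) * ((A x / a) powr \<theta> * (B x / b) powr (1 - \<theta>)) \<le>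
          a powr \<theta> * b powr (1 - \<theta>) * (\<theta> * (A x / a) + (1 - \<theta>) * (B x / b))"
        by (intro mult_left_mono) auto
      moreover have "a powr \<theta> * b powr (1 - \<theta>) * ((A x / a) powr \<theta> * (B x / b) powr (1 - \<theta>)) = A x powr \<theta> * B x powr (1 - \<theta>)"
        using ab' by (simp add: powr_divide)
      ultimately show ?thesis by simp
    qed
    then have "(LINT x|M. A x powr \<theta> * B x powr (1 - \<theta>)) \<le>
        (LINT x|M. a powr \<theta> * b powr (1 - \<theta>) * (\<theta> / a * A x + (1 - \<theta>) / b * B x))"
      using A(1) B(1) by (intro integral_mono int) simp_all
    also have "\<dots> = a powr \<theta> * b powr (1 - \<theta>)"
      using A(1) B(1) ab' by (simp add: a_def[symmetric] b_def[symmetric])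
    finally show ?thesis by (simp add: a_def b_def)
  qed
qed

lemma Holder:
  fixes f g :: "'a \<Rightarrow> real"
  assumes f: "in_Lp M p f" and g: "in_Lp M q g" and pq: "1 < p" "q = p / (p - 1)"
  shows "integrable M (\<lambda>x. f x * g x)"
    and "\<bar>LINT x|M. f x * g x\<bar> \<le> Lp_norm M p f * Lp_norm M q g"
proof -
  have [measurable]: "f \<in> borel_measurable M" "g \<in> borel_measurable M" using f g by (auto simp: in_Lp_def)
  have q: "1 - 1 / p = 1 / q" "0 < q" using pq by (simp_all add: diff_divide_distrib)
  have \<theta>: "0 < 1 / p" "1 / p < 1" using pq(1) by auto
  have eq: "(\<bar>f x\<bar> powr p) powr (1 / p) * (\<bar>g x\<bar> powr q) powr (1 - 1 / p) = \<bar>f x * g x\<bar>" for x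
    unfolding q(1) using pq(1) q(2) by (simp add: powr_powr abs_mult)
  note H = Holder_powr[OF in_Lp_integrable[OF f] powr_ge_zero in_Lp_integrable[OF g] powr_ge_zero \<theta>, unfolded eq]
  have "integrable M (\<lambda>x. \<bar>f x * g x\<bar>)" by (rule H(1))
  then show int: "integrable M (\<lambda>x. f x * g x)" by (rule integrable_abs_cancel) measurable
  have "\<bar>LINT x|M. f x * g x\<bar> \<le> (LINT x|M. \<bar>f x * g x\<bar>)" by (rule integral_abs_bound)
  also have "\<dots> \<le> Lp_norm M p f * Lp_norm M q g" using H(2) by (simp add: Lp_norm_def q(1))
  finally show "\<bar>LINT x|M. f x * g x\<bar> \<le> Lp_norm M p f * Lp_norm M q g" .
qed

section \<open>Integrated form of the monotonicity inequalities\<close>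

lemma measurable_sgn_powr [measurable]: "sgn_powr p \<in> borel_measurable borel"
  unfolding sgn_powr_def[abs_def] by measurable

lemma in_Lp_sgn_powr:
  assumes "in_Lp M p f" "1 < p" "q = p / (p - 1)"
  shows "in_Lp M q (\<lambda>x. sgn_powr p (f x))"
  using assms by (auto simp: in_Lp_def abs_sgn_powr powr_powr)

lemma Lp_norm_sgn_powr_diff_ge2:
  assumes f: "in_Lp M p f" and g: "in_Lp M p g" and p: "2 \<le> p"
  shows "2 powr (2 - p) * Lp_norm M p (\<lambda>x. f x - g x) powr p \<le>
    (LINT x|M. (sgn_powr p (f x) - sgn_powr p (g x)) * (f x - g x))"
proof -
  have "1 < p" using p by simp
  note int = Holder(1)[OF in_Lp_diff[OF f g] in_Lp_diff[OF in_Lp_sgn_powr[OF f] in_Lp_sgn_powr[OF g]] \<open>1 < p\<close>]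
  have "2 powr (2 - p) * Lp_norm M p (\<lambda>x. f x - g x) powr p = (LINT x|M. 2 powr (2 - p) * \<bar>f x - g x\<bar> powr p)"
    using p by (simp add: Lp_norm_powr)
  also have "\<dots> \<le> (LINT x|M. (sgn_powr p (f x) - sgn_powr p (g x)) * (f x - g x))"
    using p int in_Lp_diff[OF f g]
    by (intro integral_mono sgn_powr_mono_ge2) (auto simp: in_Lp_def mult.commute)
  finally show ?thesis .
qed

text \<open>The pointwise bound (p-1) d^2 <= A B^((2-p)/p) is raised to the power p/2, so that d^p
  stands against A^(p/2) B^(1-p/2). Hoelder's inequality with \<theta> = p/2 separates the integrals
  of A and B, and the power p/2 is cancelled at the end.\<close>

lemma Lp_norm_sgn_powr_diff_lt2:
  assumes f: "in_Lp M p f" and g: "in_Lp M p g" and p: "1 < p" "p < 2"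
  shows "(p - 1) * (Lp_norm M p (\<lambda>x. f x - g x))\<^sup>2 \<le>
    (LINT x|M. (sgn_powr p (f x) - sgn_powr p (g x)) * (f x - g x)) *
    (Lp_norm M p f powr p + Lp_norm M p g powr p) powr ((2 - p) / p)"
proof -
  define A where "A x = (sgn_powr p (f x) - sgn_powr p (g x)) * (f x - g x)" for x
  define B where "B x = \<bar>f x\<bar> powr p + \<bar>g x\<bar> powr p" for x
  define S where "S = Lp_norm M p f powr p + Lp_norm M p g powr p"
  have intA: "integrable M A"
    using Holder(1)[OF in_Lp_diff[OF f g] in_Lp_diff[OF in_Lp_sgn_powr[OF f] in_Lp_sgn_powr[OF g]] p(1)] p
    by (simp add: A_def[abs_def] mult.commute)
  have intB: "integrable M B" using f g by (simp add: B_def[abs_def] in_Lp_def)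
  have ptw: "(p - 1) * (f x - g x)\<^sup>2 \<le> A x * B x powr ((2 - p) / p)" for x
    unfolding A_def B_def by (rule sgn_powr_mono_lt2[OF p])
  have B0: "0 \<le> B x" for x by (simp add: B_def)
  \<comment> \<open>Nonnegativity is read off from the pointwise bound by dividing by the positive
    power of \<open>B x\<close>; where \<open>B x\<close> is zero, both functions vanish.\<close>
  have A0: "0 \<le> A x" for x
  proof (cases "B x = 0")
    case True
    then have "f x = 0 \<and> g x = 0" by (simp add: B_def add_nonneg_eq_0_iff)
    then show ?thesis by (simp add: A_def)
  next
    case False
    then have "0 < B x powr ((2 - p) / p)" using B0[of x] by simp
    moreover have "0 \<le> A x * B x powr ((2 - p) / p)"
      using p by (intro order_trans[OF _ ptw]) auto
    ultimately show ?thesis by (simp add: zero_le_mult_iff)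
  qed
  have th: "0 < p / 2" "p / 2 < 1" "1 - p / 2 = (2 - p) / 2" using p by (auto simp: field_simps)
  have le: "(p - 1) powr (p / 2) * \<bar>f x - g x\<bar> powr p \<le> A x powr (p / 2) * B x powr (1 - p / 2)" for x
  proof -
    have "(p - 1) powr (p / 2) * \<bar>f x - g x\<bar> powr p = ((p - 1) * (f x - g x)\<^sup>2) powr (p / 2)"
    proof -
      have "((f x - g x)\<^sup>2) powr (p / 2) = \<bar>f x - g x\<bar> powr p"
        using powr_powr[of "\<bar>f x - g x\<bar>" 2 "p / 2"] by (cases "f x = g x") (auto simp: powr_numeral)
      then show ?thesis using p by (simp add: powr_mult)
    qed
    also have "\<dots> \<le> (A x * B x powr ((2 - p) / p)) powr (p / 2)"
      using p by (intro powr_mono2 ptw) auto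
    also have "\<dots> = A x powr (p / 2) * B x powr (1 - p / 2)"
      unfolding th(3) using p(1) by (simp add: powr_mult powr_powr)
    finally show ?thesis .
  qed
  define I where "I = (LINT x|M. A x)"
  have I0: "0 \<le> I" using A0 by (simp add: I_def)
  have S: "(LINT x|M. B x) = S" using f g p by (simp add: S_def B_def in_Lp_def Lp_norm_powr)
  have S0: "0 \<le> S" by (simp add: S_def)
  define n where "n = Lp_norm M p (\<lambda>x. f x - g x)"
  have n0: "0 \<le> n" by (simp add: n_def Lp_norm_nonneg)
  have "((p - 1) * n\<^sup>2) powr (p / 2) = (p - 1) powr (p / 2) * n powr p"
    using powr_powr[of n 2 "p / 2"] n0 p by (cases "n = 0") (auto simp: powr_numeral powr_mult)
  also have "\<dots> = (LINT x|M. (p - 1) powr (p / 2) * \<bar>f x - g x\<bar> powr p)"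
    using p by (simp add: n_def Lp_norm_powr)
  also have "\<dots> \<le> (LINT x|M. A x powr (p / 2) * B x powr (1 - p / 2))"
    using in_Lp_diff[OF f g] p th Holder_powr(1)[OF intA A0 intB B0, of "p / 2"]
    by (intro integral_mono le) (auto simp: in_Lp_def)
  also have "\<dots> \<le> I powr (p / 2) * S powr (1 - p / 2)"
    unfolding I_def S[symmetric] by (rule Holder_powr(2)[OF intA A0 intB B0 th(1,2)])
  also have "\<dots> = (I * S powr ((2 - p) / p)) powr (p / 2)"
    unfolding th(3) using p(1) by (simp add: powr_mult powr_powr)
  finally have "(p - 1) * n\<^sup>2 \<le> I * S powr ((2 - p) / p)"
    by (rule powr_le_powr_cancel) (use p I0 in auto)
  then show ?thesis by (simp add: n_def I_def A_def S_def)
qed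

section \<open>Lebesgue measure on a product\<close>

lemma AE_lborel_pair:
  assumes "AE z in (lborel :: ('a::euclidean_space \<times> 'b::euclidean_space) measure). P z"
  shows "AE x in lborel. AE y in lborel. P (x, y)"
  by (rule lborel_pair.AE_pair) (unfold lborel_prod, rule assms)

text \<open>\<open>lebesgue\<close> on the product completes the product of the Borel measures and
  is not itself a product of completions. Hence the exceptional set is first covered by a Borel null
  set \<open>N\<close>, whose cylinder is null in the product.\<close>

lemma AE_lebesgue_fst:
  assumes "AE x in (lebesgue :: 'a::euclidean_space measure). P x"
  shows "AE z in (lebesgue :: ('a \<times> 'b::euclidean_space) measure). P (fst z)"
proof -
  from assms have "AE x in (lborel :: 'a measure). P x" by (simp add: AE_completion_iff)
  then obtain N where N: "N \<in> null_sets (lborel :: 'a measure)" "{x. \<not> P x} \<subseteq> N"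
    by (auto elim!: AE_E simp: null_sets_def)
  have "emeasure (lborel :: ('a \<times> 'b) measure) (N \<times> UNIV) = 0"
    unfolding lborel_prod[symmetric] using N lborel.emeasure_pair_measure_Times[of N lborel UNIV]
    by (auto simp: null_sets_def)
  moreover have "N \<times> UNIV \<in> sets (lborel :: ('a \<times> 'b) measure)"
    unfolding lborel_prod[symmetric] using N by (intro pair_measureI) (auto simp: null_sets_def)
  ultimately have "AE z in (lborel :: ('a \<times> 'b) measure). P (fst z)"
    using N by (intro AE_I'[of "N \<times> UNIV"]) (auto simp: null_sets_def)
  then show ?thesis by (rule AE_completion)
qed

lemma AE_lebesgue_snd:
  assumes "AE x in (lebesgue :: 'b::euclidean_space measure). P x"
  shows "AE z in (lebesgue :: ('a::euclidean_space \<times> 'b) measure). P (snd z)"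
proof -
  from assms have "AE x in (lborel :: 'b measure). P x" by (simp add: AE_completion_iff)
  then obtain N where N: "N \<in> null_sets (lborel :: 'b measure)" "{x. \<not> P x} \<subseteq> N"
    by (auto elim!: AE_E simp: null_sets_def)
  have "emeasure (lborel :: ('a \<times> 'b) measure) (UNIV \<times> N) = 0"
    unfolding lborel_prod[symmetric] using N lborel.emeasure_pair_measure_Times[of UNIV lborel N]
    by (auto simp: null_sets_def)
  moreover have "UNIV \<times> N \<in> sets (lborel :: ('a \<times> 'b) measure)"
    unfolding lborel_prod[symmetric] using N by (intro pair_measureI) (auto simp: null_sets_def)
  ultimately have "AE z in (lborel :: ('a \<times> 'b) measure). P (snd z)"
    using N by (intro AE_I'[of "UNIV \<times> N"]) (auto simp: null_sets_def)
  then show ?thesis by (rule AE_completion)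
qed

lemma borel_measurable_lebesgue_cong_AE:
  fixes f g :: "'a::euclidean_space \<Rightarrow> real"
  assumes "g \<in> borel_measurable borel" "AE x in lebesgue. f x = g x"
  shows "f \<in> borel_measurable lebesgue"
proof (rule borel_measurable_AE)
  show "g \<in> borel_measurable lebesgue" using assms(1) by (intro measurable_completion) simp
  show "AE x in lebesgue. g x = f x" using assms(2) by eventually_elim simp
qed

lemma measurable_lebesgue_fst:
  fixes u :: "'a::euclidean_space \<Rightarrow> real"
  assumes "u \<in> borel_measurable lebesgue"
  shows "(\<lambda>z. u (fst z)) \<in> borel_measurable (lebesgue :: ('a \<times> 'b::euclidean_space) measure)"
proof -
  obtain u' where u': "u' \<in> borel_measurable borel" "AE x in lborel. u x = u' x"
    using completion_ex_borel_measurable_real[OF assms] by auto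
  have "(\<lambda>z :: 'a \<times> 'b. u' (fst z)) \<in> borel_measurable borel"
    by (rule measurable_compose[OF borel_measurable_continuous_onI u'(1)]) (intro continuous_intros)
  then show ?thesis
    by (rule borel_measurable_lebesgue_cong_AE) (rule AE_lebesgue_fst[OF AE_completion[OF u'(2)]])
qed

lemma measurable_lebesgue_snd:
  fixes u :: "'b::euclidean_space \<Rightarrow> real"
  assumes "u \<in> borel_measurable lebesgue"
  shows "(\<lambda>z. u (snd z)) \<in> borel_measurable (lebesgue :: ('a::euclidean_space \<times> 'b) measure)"
proof -
  obtain u' where u': "u' \<in> borel_measurable borel" "AE x in lborel. u x = u' x"
    using completion_ex_borel_measurable_real[OF assms] by auto
  have "(\<lambda>z :: 'a \<times> 'b. u' (snd z)) \<in> borel_measurable borel"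
    by (rule measurable_compose[OF borel_measurable_continuous_onI u'(1)]) (intro continuous_intros)
  then show ?thesis
    by (rule borel_measurable_lebesgue_cong_AE) (rule AE_lebesgue_snd[OF AE_completion[OF u'(2)]])
qed

text \<open>Fubini's theorem for the completed measure, by passing to a Borel representative
  \<open>k'\<close>. The slices of \<open>k\<close> agree with those of \<open>k'\<close>, and are
  thereby measurable, only for almost every \<open>x\<close>, so the inner integrals are compared
  almost everywhere.\<close>

lemma lebesgue_Fubini:
  fixes k :: "'a::euclidean_space \<times> 'b::euclidean_space \<Rightarrow> real"
  assumes "integrable lebesgue k"
  shows "integrable lebesgue (\<lambda>x. LINT y|lebesgue. k (x, y))"
    and "(LINT z|lebesgue. k z) = (LINT x|lebesgue. LINT y|lebesgue. k (x, y))"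
proof -
  have k: "k \<in> borel_measurable lebesgue" using assms by auto
  obtain k' where k': "k' \<in> borel_measurable lborel" "AE z in lborel. k z = k' z"
    using completion_ex_borel_measurable_real[OF k] by auto
  have [measurable]: "k' \<in> borel_measurable borel" using k' by simp
  then have [measurable]: "k' \<in> borel_measurable (lborel \<Otimes>\<^sub>M lborel)" by (simp add: lborel_prod)
  have AEz: "AE z in lebesgue. k z = k' z" by (rule AE_completion[OF k'(2)])
  have "integrable lebesgue k'"
    using k by (intro Bochner_Integration.integrable_cong_AE_imp[OF assms _ AEz] measurable_completion k')
  then have int: "integrable (lborel \<Otimes>\<^sub>M lborel) k'" using k' by (simp add: integrable_completion lborel_prod)
  have meas: "(\<lambda>x. LINT y|lborel. k' (x, y)) \<in> borel_measurable lborel" by measurable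
  have "AE x in lborel. AE y in lborel. k (x, y) = k' (x, y)" by (rule AE_lborel_pair[OF k'(2)])
  then have "AE x in lborel. (LINT y|lebesgue. k (x, y)) = (LINT y|lborel. k' (x, y))"
  proof eventually_elim
    case (elim x)
    have m: "(\<lambda>y. k' (x, y)) \<in> borel_measurable lborel" by measurable
    have AE: "AE y in lebesgue. k (x, y) = k' (x, y)" using elim by (rule AE_completion)
    have "(\<lambda>y. k (x, y)) \<in> borel_measurable lebesgue"
      by (rule borel_measurable_lebesgue_cong_AE[OF _ AE]) measurable
    then have "(LINT y|lebesgue. k (x, y)) = (LINT y|lebesgue. k' (x, y))"
      by (rule integral_cong_AE[OF _ measurable_completion[OF m] AE])
    then show ?case using m by (simp add: integral_completion)
  qed
  then have AEx: "AE x in lebesgue. (LINT y|lebesgue. k (x, y)) = (LINT y|lborel. k' (x, y))"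
    by (rule AE_completion)
  have meas': "(\<lambda>x. LINT y|lebesgue. k (x, y)) \<in> borel_measurable lebesgue"
    by (rule borel_measurable_lebesgue_cong_AE[OF _ AEx]) (use meas in simp)
  have "integrable lebesgue (\<lambda>x. LINT y|lborel. k' (x, y))"
    using lborel_pair.integrable_fst'[OF int] meas by (simp add: integrable_completion)
  then show "integrable lebesgue (\<lambda>x. LINT y|lebesgue. k (x, y))"
    using AEx meas' by (rule_tac Bochner_Integration.integrable_cong_AE_imp) (auto elim: eventually_mono)
  have "(LINT z|lebesgue. k z) = (LINT z|lebesgue. k' z)"
    by (intro integral_cong_AE AEz k measurable_completion k')
  also have "\<dots> = (LINT z|(lborel \<Otimes>\<^sub>M lborel). k' z)" using k' by (simp add: integral_completion lborel_prod)
  also have "\<dots> = (LINT x|lborel. LINT y|lborel. k' (x, y))"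
    by (rule lborel_pair.integral_fst'[OF int, symmetric])
  also have "\<dots> = (LINT x|lebesgue. LINT y|lborel. k' (x, y))"
    using meas by (simp add: integral_completion)
  also have "\<dots> = (LINT x|lebesgue. LINT y|lebesgue. k (x, y))"
    using AEx by (intro integral_cong_AE meas' measurable_completion meas) (auto elim: eventually_mono)
  finally show "(LINT z|lebesgue. k z) = (LINT x|lebesgue. LINT y|lebesgue. k (x, y))" .
qed

text \<open>Reflection in the diagonal preserves the product measure; the passage through a Borel
  representative is as for Fubini's theorem. Combined with the antisymmetry of a kernel, this
  exchanges the roles of the two variables.\<close>

lemma lebesgue_swap:
  fixes k :: "'a::euclidean_space \<times> 'b::euclidean_space \<Rightarrow> real"
  assumes "integrable lebesgue k"
  shows "integrable lebesgue (\<lambda>(x, y). k (y, x))"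
    and "(LINT z|lebesgue. (case z of (x, y) \<Rightarrow> k (y, x))) = (LINT z|lebesgue. k z)"
proof -
  have k: "k \<in> borel_measurable lebesgue" using assms by auto
  obtain k' where k': "k' \<in> borel_measurable lborel" "AE z in lborel. k z = k' z"
    using completion_ex_borel_measurable_real[OF k] by auto
  have [measurable]: "k' \<in> borel_measurable (lborel \<Otimes>\<^sub>M lborel)" using k' by (simp add: lborel_prod)
  have AEz: "AE z in lebesgue. k z = k' z" by (rule AE_completion[OF k'(2)])
  have "integrable lebesgue k'"
    using k by (intro Bochner_Integration.integrable_cong_AE_imp[OF assms _ AEz] measurable_completion k')
  then have int: "integrable (lborel \<Otimes>\<^sub>M lborel) k'" using k' by (simp add: integrable_completion lborel_prod)
  have "AE z in distr (lborel \<Otimes>\<^sub>M lborel) (lborel \<Otimes>\<^sub>M lborel) (\<lambda>(x, y). (y, x)). k z = k' z"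
    by (subst lborel_pair.distr_pair_swap[symmetric], subst lborel_prod) (rule k'(2))
  then have "AE z in (lborel \<Otimes>\<^sub>M lborel). (case z of (x, y) \<Rightarrow> k (y, x)) = (case z of (x, y) \<Rightarrow> k' (y, x))"
    by (auto dest!: AE_distrD[rotated] elim!: eventually_mono)
  then have AEs: "AE z in lebesgue. (case z of (x, y) \<Rightarrow> k (y, x)) = (case z of (x, y) \<Rightarrow> k' (y, x))"
    unfolding lborel_prod by (rule AE_completion)
  have m: "(\<lambda>(x, y). k' (y, x)) \<in> borel_measurable (lborel \<Otimes>\<^sub>M lborel)" by measurable
  then have m': "(\<lambda>(x, y). k' (y, x)) \<in> borel_measurable lborel" by (simp add: lborel_prod)
  have ms: "(\<lambda>(x, y). k (y, x)) \<in> borel_measurable lebesgue"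
    by (rule borel_measurable_lebesgue_cong_AE[OF _ AEs]) (use m' in simp)
  have "integrable (lborel \<Otimes>\<^sub>M lborel) (\<lambda>(x, y). k' (y, x))"
    using int by (rule lborel_pair.integrable_product_swap)
  then have "integrable lebesgue (\<lambda>(x, y). k' (y, x))" using m' by (simp add: integrable_completion lborel_prod)
  then show "integrable lebesgue (\<lambda>(x, y). k (y, x))"
    using AEs ms by (rule_tac Bochner_Integration.integrable_cong_AE_imp) (auto elim: eventually_mono)
  have "(LINT z|lebesgue. (case z of (x, y) \<Rightarrow> k (y, x))) = (LINT z|lebesgue. (case z of (x, y) \<Rightarrow> k' (y, x)))"
    by (intro integral_cong_AE AEs ms measurable_completion m')
  also have "\<dots> = (LINT z|(lborel \<Otimes>\<^sub>M lborel). (case z of (x, y) \<Rightarrow> k' (y, x)))"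
    using m' by (simp add: integral_completion lborel_prod)
  also have "\<dots> = (LINT z|(lborel \<Otimes>\<^sub>M lborel). k' z)"
    by (rule lborel_pair.integral_product_swap) measurable
  also have "\<dots> = (LINT z|lebesgue. k' z)" using k' by (simp add: integral_completion lborel_prod)
  also have "\<dots> = (LINT z|lebesgue. k z)"
    using AEz by (intro integral_cong_AE k measurable_completion k') (auto elim: eventually_mono)
  finally show "(LINT z|lebesgue. (case z of (x, y) \<Rightarrow> k (y, x))) = (LINT z|lebesgue. k z)" .
qed

section \<open>Integrability of the fractional kernel\<close>

text \<open>Replaces integration in polar coordinates. A ball of radius \<open>\<rho> k\<close>
  carrying the height \<open>c k / \<rho> k ^ DIM('a)\<close> contributes the volume of the unit
  ball times \<open>c k\<close>, whatever the radius, so summability of \<open>c\<close>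
  suffices.\<close>

lemma nn_integral_cball_cover:
  fixes f :: "'a::euclidean_space \<Rightarrow> real" and \<rho> c :: "nat \<Rightarrow> real"
  assumes [measurable]: "f \<in> borel_measurable borel"
    and \<rho>: "\<And>k. 0 < \<rho> k" and c: "\<And>k. 0 \<le> c k" "summable c"
    and cover: "\<And>z. 0 < f z \<Longrightarrow> \<exists>k. norm z \<le> \<rho> k \<and> f z \<le> c k / \<rho> k ^ DIM('a)"
  shows "(\<integral>\<^sup>+z. ennreal (f z) \<partial>lborel) < \<infinity>"
proof -
  have [measurable]: "cball (0 :: 'a) r \<in> sets borel" for r by simp
  have "(\<integral>\<^sup>+z. ennreal (f z) \<partial>lborel) \<le>
      (\<integral>\<^sup>+z. (\<Sum>k. ennreal (c k / \<rho> k ^ DIM('a)) * indicator (cball 0 (\<rho> k)) z) \<partial>(lborel :: 'a measure))"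
  proof (rule nn_integral_mono)
    fix z
    show "ennreal (f z) \<le> (\<Sum>k. ennreal (c k / \<rho> k ^ DIM('a)) * indicator (cball 0 (\<rho> k)) z)"
    proof (cases "0 < f z")
      case True
      then obtain k where k: "norm z \<le> \<rho> k" "f z \<le> c k / \<rho> k ^ DIM('a)" using cover by blast
      have "ennreal (f z) \<le> (\<Sum>k\<in>{k}. ennreal (c k / \<rho> k ^ DIM('a)) * indicator (cball 0 (\<rho> k)) z)"
        using k by (simp add: ennreal_leI)
      also have "\<dots> \<le> (\<Sum>k. ennreal (c k / \<rho> k ^ DIM('a)) * indicator (cball 0 (\<rho> k)) z)"
        by (rule sum_le_suminf) auto
      finally show ?thesis .
    qed (simp add: ennreal_neg)
  qed
  also have "\<dots> = (\<Sum>k. \<integral>\<^sup>+z. ennreal (c k / \<rho> k ^ DIM('a)) * indicator (cball 0 (\<rho> k)) z \<partial>(lborel :: 'a measure))"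
    by (rule nn_integral_suminf) measurable
  also have "\<dots> = (\<Sum>k. ennreal (unit_ball_vol (DIM('a)) * c k))"
  proof (rule suminf_cong)
    fix k
    have "(\<integral>\<^sup>+z. ennreal (c k / \<rho> k ^ DIM('a)) * indicator (cball 0 (\<rho> k)) z \<partial>(lborel :: 'a measure)) =
        ennreal (c k / \<rho> k ^ DIM('a)) * emeasure lborel (cball 0 (\<rho> k) :: 'a set)"
      by (subst nn_integral_cmult_indicator) auto
    also have "\<dots> = ennreal (c k / \<rho> k ^ DIM('a)) * ennreal (unit_ball_vol (DIM('a)) * \<rho> k ^ DIM('a))"
      using \<rho>[of k] by (subst emeasure_cball) auto
    also have "\<dots> = ennreal (unit_ball_vol (DIM('a)) * c k)"
      using \<rho>[of k] c(1)[of k] by (subst ennreal_mult[symmetric]) (auto simp: field_simps)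
    finally show "(\<integral>\<^sup>+z. ennreal (c k / \<rho> k ^ DIM('a)) * indicator (cball 0 (\<rho> k)) z \<partial>(lborel :: 'a measure)) =
        ennreal (unit_ball_vol (DIM('a)) * c k)" .
  qed
  also have "\<dots> < \<infinity>"
    unfolding infinity_ennreal_def less_top[symmetric]
    using c by (intro ennreal_suminf_neq_top summable_mult) auto
  finally show ?thesis .
qed

lemma ex_dyadic_interval:
  fixes t :: real
  assumes "1 \<le> t"
  shows "\<exists>k::nat. 2 ^ k \<le> t \<and> t \<le> 2 ^ (k + 1)"
proof -
  define k where "k = (LEAST k::nat. t < 2 ^ k)"
  have ex: "\<exists>k::nat. t < 2 ^ k" using real_arch_pow[of 2 t] by simp
  have k: "t < 2 ^ k" unfolding k_def by (rule LeastI_ex[OF ex])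
  then have "k \<noteq> 0" using assms by (cases k) auto
  then have "\<not> t < 2 ^ (k - 1)" unfolding k_def by (intro not_less_Least) auto
  then show ?thesis using k \<open>k \<noteq> 0\<close> by (intro exI[of _ "k - 1"]) auto
qed

lemma power_powr_simps:
  fixes a :: real and k n :: nat
  shows "((2::real) ^ k) powr a = (2 powr a) ^ k" "0 < x \<Longrightarrow> x powr real n = x ^ n"
  by (simp_all add: powr_powr powr_realpow flip: powr_realpow) (simp add: powr_powr mult.commute)

text \<open>Near 0 the kernel is |z|^(p(1-s)-N), integrable because s < 1; far away it is
  |z|^(-N-ps), integrable because s > 0. Dyadic shells turn the two halves into geometric series of
  ratio 2^(-p(1-s)) and 2^(-ps).\<close>

lemma fractional_kernel_integrable:
  fixes p s :: real
  assumes p: "0 < p" and s: "0 < s" "s < 1"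
  shows "(\<integral>\<^sup>+z. ennreal (min (norm z powr p) 1 / norm z powr (real DIM('a) + p * s)) \<partial>(lborel :: 'a::euclidean_space measure)) < \<infinity>"
proof -
  define f :: "'a \<Rightarrow> real" where "f z = min (norm z powr p) 1 / norm z powr (real DIM('a) + p * s)" for z
  have [measurable]: "f \<in> borel_measurable borel" unfolding f_def by measurable
  have [measurable]: "ball (0 :: 'a) 1 \<in> sets borel" "- ball (0 :: 'a) 1 \<in> sets borel" by auto
  define g1 where "g1 z = f z * indicator (ball 0 1) z" for z
  define g2 where "g2 z = f z * indicator (- ball 0 1) z" for z
  have [measurable]: "g1 \<in> borel_measurable borel" "g2 \<in> borel_measurable borel"
    unfolding g1_def g2_def by measurable
  have 1: "(\<integral>\<^sup>+z. ennreal (g1 z) \<partial>lborel) < \<infinity>"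
  \<comment> \<open>Shell number \<open>k\<close> lies between the radii 2^(-k-1) and 2^(-k). The
    factor \<open>2 ^ DIM('a)\<close> pays for using the outer radius of the ball where the inner
    radius bounds the kernel; the same happens in the outer half.\<close>
  proof (rule nn_integral_cball_cover[where \<rho> = "\<lambda>k. 1 / 2 ^ k" and c = "\<lambda>k. 2 ^ DIM('a) * (2 powr (- (p * (1 - s)))) ^ k"])
    show "summable (\<lambda>k. 2 ^ DIM('a) * (2 powr (- (p * (1 - s)))) ^ k)"
      using p s by (intro summable_mult summable_geometric) (auto simp: powr_less_one)
    fix z :: 'a assume "0 < g1 z"
    then have z: "0 < norm z" "norm z < 1" by (cases "norm z < 1"; auto simp: g1_def f_def)+
    then obtain k where k: "2 ^ k \<le> 1 / norm z" "1 / norm z \<le> 2 ^ (k + 1)"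
      using ex_dyadic_interval[of "1 / norm z"] by auto
    have k': "norm z \<le> 1 / 2 ^ k" "inverse (norm z) \<le> 2 ^ (k + 1)" using k z by (auto simp: field_simps)
    have "g1 z = f z" using z by (simp add: g1_def)
    also have "f z \<le> norm z powr p / norm z powr (real DIM('a) + p * s)"
      unfolding f_def by (intro divide_right_mono) auto
    also have "\<dots> = norm z powr (p * (1 - s)) * inverse (norm z) ^ DIM('a)"
      using z by (simp add: powr_add powr_diff powr_realpow right_diff_distrib field_simps)
    also have "\<dots> \<le> (1 / 2 ^ k) powr (p * (1 - s)) * (2 ^ (k + 1)) ^ DIM('a)"
      using k' p s by (intro mult_mono powr_mono2 power_mono) auto
    also have "(1 / 2 ^ k) powr (p * (1 - s)) = (2 powr (- (p * (1 - s)))) ^ k"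
      unfolding powr_minus by (simp only: powr_divide power_powr_simps(1) power_inverse powr_one_eq_one inverse_eq_divide power_one_over)
    also have "(2 powr (- (p * (1 - s)))) ^ k * (2 ^ (k + 1)) ^ DIM('a) = 2 ^ DIM('a) * (2 powr (- (p * (1 - s)))) ^ k / (1 / 2 ^ k) ^ DIM('a)"
      by (simp only: power_one_over power_mult_distrib power_add power_one_right) simp
    finally show "\<exists>k. norm z \<le> 1 / 2 ^ k \<and> g1 z \<le> 2 ^ DIM('a) * (2 powr (- (p * (1 - s)))) ^ k / (1 / 2 ^ k) ^ DIM('a)"
      using k' by blast
  qed auto
  have 2: "(\<integral>\<^sup>+z. ennreal (g2 z) \<partial>lborel) < \<infinity>"
  proof (rule nn_integral_cball_cover[where \<rho> = "\<lambda>k. 2 ^ (k + 1)" and c = "\<lambda>k. 2 ^ DIM('a) * (2 powr (- (p * s))) ^ k"])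
    show "summable (\<lambda>k. 2 ^ DIM('a) * (2 powr (- (p * s))) ^ k)"
      using p s by (intro summable_mult summable_geometric) (auto simp: powr_less_one)
    fix z :: 'a assume "0 < g2 z"
    then have z: "1 \<le> norm z" by (cases "norm z < 1") (auto simp: g2_def)
    then obtain k where k: "2 ^ k \<le> norm z" "norm z \<le> 2 ^ (k + 1)"
      using ex_dyadic_interval[of "norm z"] by auto
    have "g2 z = f z" using z by (simp add: g2_def)
    also have "f z \<le> 1 / norm z powr (real DIM('a) + p * s)"
      unfolding f_def by (intro divide_right_mono) auto
    also have "\<dots> \<le> 1 / (2 ^ k) powr (real DIM('a) + p * s)"
      using k p s z by (intro divide_left_mono powr_mono2 mult_pos_pos) auto
    also have "\<dots> = 2 ^ DIM('a) * (2 powr (- (p * s))) ^ k / (2 ^ (k + 1)) ^ DIM('a)"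
      by (simp add: powr_add power_powr_simps powr_minus power_mult_distrib field_simps flip: power_mult)
    finally show "\<exists>k. norm z \<le> 2 ^ (k + 1) \<and> g2 z \<le> 2 ^ DIM('a) * (2 powr (- (p * s))) ^ k / (2 ^ (k + 1)) ^ DIM('a)"
      using k by blast
  qed auto
  have "(\<integral>\<^sup>+z. ennreal (f z) \<partial>lborel) = (\<integral>\<^sup>+z. ennreal (g1 z) + ennreal (g2 z) \<partial>lborel)"
    by (intro nn_integral_cong) (auto simp: g1_def g2_def indicator_def)
  also have "\<dots> = (\<integral>\<^sup>+z. ennreal (g1 z) \<partial>lborel) + (\<integral>\<^sup>+z. ennreal (g2 z) \<partial>lborel)"
    by (rule nn_integral_add) auto
  also have "\<dots> < \<infinity>" using 1 2 by simp
  finally show ?thesis by (simp add: f_def)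
qed

text \<open>A Lipschitz and bounded function satisfies |\<phi> x - \<phi> y| <= max(L, 2M)
  min(|x-y|, 1), and the difference vanishes unless one of the points lies in the ball
  \<open>B\<close>. Integrating first in the other variable gives, by translation invariance, the
  finite kernel integral \<open>I\<close>, and then the volume of \<open>B\<close> remains.\<close>

lemma Lipschitz_bounded_support_gagliardo:
  fixes \<phi> :: "'a::euclidean_space \<Rightarrow> real"
  assumes p: "0 < p" and s: "0 < s" "s < 1"
    and L: "\<And>x y. \<bar>\<phi> x - \<phi> y\<bar> \<le> L * norm (x - y)" and M: "\<And>x. \<bar>\<phi> x\<bar> \<le> M"
    and K: "bounded K" "\<And>x. x \<notin> K \<Longrightarrow> \<phi> x = 0" and cont: "continuous_on UNIV \<phi>"
  shows "integrable lebesgue (gagliardo_integrand p s \<phi>)"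
proof -
  obtain R where R: "0 < R" "K \<subseteq> cball 0 R" using K(1) by (fastforce simp: bounded_pos subset_eq)
  define B where "B = cball (0 :: 'a) R"
  define f :: "'a \<Rightarrow> real" where "f z = min (norm z powr p) 1 / norm z powr (real DIM('a) + p * s)" for z
  have [measurable]: "f \<in> borel_measurable borel" unfolding f_def by measurable
  have [measurable]: "B \<in> sets borel" by (simp add: B_def)
  have fneg: "f (- z) = f z" for z by (simp add: f_def)
  define I where "I = (\<integral>\<^sup>+z. ennreal (f z) \<partial>lborel)"
  have I: "I < \<infinity>" unfolding I_def f_def by (rule fractional_kernel_integrable[OF p s])
  have trans: "(\<integral>\<^sup>+y. ennreal (f (y - x)) \<partial>lborel) = I" for x
  proof -
    have "(\<integral>\<^sup>+y. ennreal (f (y - x)) \<partial>lborel) = (\<integral>\<^sup>+y. ennreal (f (y - x)) \<partial>distr lborel borel ((+) x))"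
      by (simp add: lborel_distr_plus)
    also have "\<dots> = I" unfolding I_def by (subst nn_integral_distr) auto
    finally show ?thesis .
  qed
  have trans': "(\<integral>\<^sup>+y. ennreal (f (x - y)) \<partial>lborel) = I" for x
  proof -
    have "f (x - y) = f (y - x)" for y using fneg[of "y - x"] by simp
    then have "(\<integral>\<^sup>+y. ennreal (f (x - y)) \<partial>lborel) = (\<integral>\<^sup>+y. ennreal (f (y - x)) \<partial>lborel)"
      by (intro nn_integral_cong) (rule arg_cong)
    then show ?thesis using trans[of x] by (rule HOL.trans)
  qed
  have [measurable]: "\<phi> \<in> borel_measurable borel" using cont by (rule borel_measurable_continuous_onI)
  define G where "G = gagliardo_integrand p s \<phi>"
  have G_meas: "G \<in> borel_measurable (lborel \<Otimes>\<^sub>M lborel)"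
    unfolding G_def gagliardo_integrand_def by measurable
  have L0: "0 \<le> L"
  proof -
    obtain b :: 'a where "b \<in> Basis" using nonempty_Basis by blast
    then show ?thesis using L[of b 0] by (simp add: norm_Basis)
  qed
  define c where "c = max L (2 * M) powr p"
  have G_le: "G (x, y) \<le> c * f (x - y) * indicator B x + c * f (x - y) * indicator B y" for x y
  proof (cases "x \<in> B \<or> y \<in> B")
    case True
    have "\<bar>\<phi> x - \<phi> y\<bar> \<le> max L (2 * M) * min (norm (x - y)) 1"
    proof -
      have "\<bar>\<phi> x - \<phi> y\<bar> \<le> 2 * M" using M[of x] M[of y] by linarith
      moreover have "\<bar>\<phi> x - \<phi> y\<bar> \<le> max L (2 * M) * norm (x - y)"
        by (rule order_trans[OF L]) (intro mult_right_mono, auto)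
      moreover have "2 * M \<le> max L (2 * M) * 1" by simp
      ultimately have "\<bar>\<phi> x - \<phi> y\<bar> \<le> max L (2 * M) * 1" by (blast intro: order_trans)
      with \<open>\<bar>\<phi> x - \<phi> y\<bar> \<le> max L (2 * M) * norm (x - y)\<close> show ?thesis unfolding min_def by presburger
    qed
    then have "\<bar>\<phi> x - \<phi> y\<bar> powr p \<le> (max L (2 * M) * min (norm (x - y)) 1) powr p"
      using p by (intro powr_mono2) auto
    also have "\<dots> = c * min (norm (x - y) powr p) 1"
      using powr_mono2[of p "norm (x - y)" 1] powr_mono2[of p 1 "norm (x - y)"] p
      by (cases "norm (x - y) \<le> 1") (simp_all add: powr_mult c_def min_def)
    finally have "G (x, y) \<le> c * min (norm (x - y) powr p) 1 / norm (x - y) powr (real DIM('a) + p * s)"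
      unfolding G_def gagliardo_integrand_def by (simp add: divide_right_mono)
    then have *: "G (x, y) \<le> c * f (x - y)" by (simp add: f_def)
    have "0 \<le> c * f (x - y)" by (simp add: c_def f_def)
    with * True show ?thesis by (auto simp: indicator_def)
  next
    case False
    then have "x \<notin> K" "y \<notin> K" using R by (auto simp: B_def)
    then have "\<phi> x = 0" "\<phi> y = 0" by (simp_all add: K(2))
    then show ?thesis using False p by (simp add: G_def gagliardo_integrand_def)
  qed
  have c0: "0 \<le> c" "\<And>z. 0 \<le> f z" by (auto simp: c_def f_def)
  have vB: "emeasure lborel B < \<infinity>" using R by (simp add: B_def emeasure_cball)
  have 1: "(\<integral>\<^sup>+z. ennreal (case z of (x, y) \<Rightarrow> c * f (x - y) * indicator B x) \<partial>(lborel \<Otimes>\<^sub>M lborel)) < \<infinity>"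
  proof -
    have "(\<integral>\<^sup>+z. ennreal (case z of (x, y) \<Rightarrow> c * f (x - y) * indicator B x) \<partial>(lborel \<Otimes>\<^sub>M lborel))
        = (\<integral>\<^sup>+x. \<integral>\<^sup>+y. ennreal (c * f (x - y) * indicator B x) \<partial>lborel \<partial>lborel)"
      by (subst lborel.nn_integral_fst[symmetric]) auto
    also have "\<dots> = (\<integral>\<^sup>+x. \<integral>\<^sup>+y. (ennreal c * indicator B x) * ennreal (f (x - y)) \<partial>lborel \<partial>lborel)"
      using c0 by (intro nn_integral_cong) (auto simp: ennreal_mult indicator_def)
    also have "\<dots> = (\<integral>\<^sup>+x. ennreal c * I * indicator B x \<partial>lborel)"
      by (subst nn_integral_cmult) (simp_all add: trans' ac_simps)
    also have "\<dots> = ennreal c * I * emeasure lborel B" by (rule nn_integral_cmult_indicator) simp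
    also have "\<dots> < \<infinity>" using I vB by (simp add: ennreal_mult_less_top)
    finally show ?thesis .
  qed
  have 2: "(\<integral>\<^sup>+z. ennreal (case z of (x, y) \<Rightarrow> c * f (x - y) * indicator B y) \<partial>(lborel \<Otimes>\<^sub>M lborel)) < \<infinity>"
  proof -
    have "(\<integral>\<^sup>+z. ennreal (case z of (x, y) \<Rightarrow> c * f (x - y) * indicator B y) \<partial>(lborel \<Otimes>\<^sub>M lborel))
        = (\<integral>\<^sup>+y. \<integral>\<^sup>+x. ennreal (c * f (x - y) * indicator B y) \<partial>lborel \<partial>lborel)"
      by (subst lborel_pair.nn_integral_snd[symmetric]) auto
    also have "\<dots> = (\<integral>\<^sup>+y. \<integral>\<^sup>+x. (ennreal c * indicator B y) * ennreal (f (x - y)) \<partial>lborel \<partial>lborel)"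
      using c0 by (intro nn_integral_cong) (auto simp: ennreal_mult indicator_def)
    also have "\<dots> = (\<integral>\<^sup>+y. ennreal c * I * indicator B y \<partial>lborel)"
      by (subst nn_integral_cmult) (simp_all add: trans ac_simps)
    also have "\<dots> = ennreal c * I * emeasure lborel B" by (rule nn_integral_cmult_indicator) simp
    also have "\<dots> < \<infinity>" using I vB by (simp add: ennreal_mult_less_top)
    finally show ?thesis .
  qed
  have "integrable (lborel \<Otimes>\<^sub>M lborel) G"
  proof (rule integrableI_nonneg)
    show "AE z in lborel \<Otimes>\<^sub>M lborel. 0 \<le> G z" by (auto simp: G_def gagliardo_integrand_def split: prod.splits)
    have "(\<integral>\<^sup>+z. ennreal (G z) \<partial>(lborel \<Otimes>\<^sub>M lborel)) \<le>
        (\<integral>\<^sup>+z. ennreal (case z of (x, y) \<Rightarrow> c * f (x - y) * indicator B x) + ennreal (case z of (x, y) \<Rightarrow> c * f (x - y) * indicator B y) \<partial>(lborel \<Otimes>\<^sub>M lborel))"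
    proof (rule nn_integral_mono)
      fix z :: "'a \<times> 'a"
      obtain x y where z: "z = (x, y)" by (cases z)
      show "ennreal (G z) \<le> ennreal (case z of (x, y) \<Rightarrow> c * f (x - y) * indicator B x) + ennreal (case z of (x, y) \<Rightarrow> c * f (x - y) * indicator B y)"
        unfolding z prod.case by (rule order_trans[OF ennreal_leI[OF G_le]]) (use c0 in simp)
    qed
    also have "\<dots> = (\<integral>\<^sup>+z. ennreal (case z of (x, y) \<Rightarrow> c * f (x - y) * indicator B x) \<partial>(lborel \<Otimes>\<^sub>M lborel)) +
       (\<integral>\<^sup>+z. ennreal (case z of (x, y) \<Rightarrow> c * f (x - y) * indicator B y) \<partial>(lborel \<Otimes>\<^sub>M lborel))"
      by (rule nn_integral_add) measurable
    also have "\<dots> < \<infinity>" using 1 2 by simp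
    finally show "(\<integral>\<^sup>+z. ennreal (G z) \<partial>(lborel \<Otimes>\<^sub>M lborel)) < \<infinity>" .
  qed (rule G_meas)
  then show ?thesis
    using G_meas by (simp add: G_def lborel_prod integrable_completion)
qed

section \<open>Test functions\<close>

lemma Ck_diff: "Ck k f \<Longrightarrow> Ck k g \<Longrightarrow> Ck k (\<lambda>x. f x - g x)"
proof (induction k arbitrary: f g)
  case 0
  then show ?case by (simp add: continuous_on_diff)
next
  case (Suc k)
  have d: "f differentiable (at x)" "g differentiable (at x)" for x using Suc.prems by auto
  have "frechet_derivative (\<lambda>x. f x - g x) (at x) = (\<lambda>h. frechet_derivative f (at x) h - frechet_derivative g (at x) h)" for x
    using has_derivative_diff[OF d(1)[unfolded frechet_derivative_works] d(2)[unfolded frechet_derivative_works], of x]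
    by (rule frechet_derivative_at[symmetric])
  moreover have "Ck k (\<lambda>x. frechet_derivative f (at x) b - frechet_derivative g (at x) b)" if "b \<in> Basis" for b
    using Suc.prems that by (intro Suc.IH) simp_all
  ultimately show ?case using d by simp
qed

lemma test_functionsD:
  assumes "f \<in> test_functions \<Omega>"
  shows "Ck k f" "compact (closure {x. f x \<noteq> 0})" "closure {x. f x \<noteq> 0} \<subseteq> \<Omega>"
  using assms by (simp_all only: test_functions_def mem_Collect_eq)

lemma test_functions_diff:
  assumes "f \<in> test_functions \<Omega>" "g \<in> test_functions \<Omega>"
  shows "(\<lambda>x. f x - g x) \<in> test_functions \<Omega>"
proof -
  have sub: "closure {x. f x - g x \<noteq> 0} \<subseteq> closure {x. f x \<noteq> 0} \<union> closure {x. g x \<noteq> 0}"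
    unfolding closure_Un[symmetric] by (rule closure_mono) auto
  have "compact (closure {x. f x \<noteq> 0} \<union> closure {x. g x \<noteq> 0})"
    by (intro compact_Un test_functionsD[OF assms(1)] test_functionsD[OF assms(2)])
  from compact_Int_closed[OF this closed_closure, of "{x. f x - g x \<noteq> 0}"] have "compact (closure {x. f x - g x \<noteq> 0})"
    unfolding Int_absorb1[OF sub] .
  moreover have "closure {x. f x - g x \<noteq> 0} \<subseteq> \<Omega>"
    using sub test_functionsD(3)[OF assms(1)] test_functionsD(3)[OF assms(2)] by blast
  moreover have "Ck k (\<lambda>x. f x - g x)" for k
    by (intro Ck_diff test_functionsD[OF assms(1)] test_functionsD[OF assms(2)])
  ultimately show ?thesis unfolding test_functions_def by simp
qed

lemma test_functions_continuous: "f \<in> test_functions \<Omega> \<Longrightarrow> continuous_on UNIV f"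
  using test_functionsD(1)[of f \<Omega> 0] by simp

lemma test_functions_bounded:
  assumes "f \<in> test_functions \<Omega>"
  obtains M where "\<And>x. \<bar>f x\<bar> \<le> M"
proof -
  let ?S = "closure {x. f x \<noteq> 0}"
  have "compact (f ` ?S)"
    by (intro compact_continuous_image test_functionsD[OF assms]
        continuous_on_subset[OF test_functions_continuous[OF assms] subset_UNIV])
  from compact_imp_bounded[OF this] obtain M where M: "0 < M" "\<And>y. y \<in> f ` ?S \<Longrightarrow> norm y \<le> M"
    unfolding bounded_pos by blast
  have "\<bar>f x\<bar> \<le> M" for x
  proof (cases "f x = 0")
    case False
    then have "x \<in> ?S" by (intro set_mp[OF closure_subset]) simp
    then show ?thesis using M(2)[of "f x"] by auto
  qed (use M in simp)
  then show thesis by (rule that)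
qed

text \<open>The partial derivatives are continuous and vanish off the compact support, hence are
  bounded; the mean value inequality on the whole space then applies.\<close>

lemma test_functions_Lipschitz:
  fixes f :: "'a::euclidean_space \<Rightarrow> real"
  assumes f: "f \<in> test_functions \<Omega>"
  obtains L where "\<And>x y. \<bar>f x - f y\<bar> \<le> L * norm (x - y)"
proof -
  let ?S = "closure {x. f x \<noteq> 0}"
  have S: "compact ?S" by (rule test_functionsD[OF f])
  have "Ck (Suc 0) f" by (rule test_functionsD[OF f])
  then have d: "\<And>x. f differentiable (at x)"
    and c: "\<And>b. b \<in> Basis \<Longrightarrow> continuous_on UNIV (\<lambda>x. frechet_derivative f (at x) b)" by auto
  define D where "D x = frechet_derivative f (at x)" for x
  have D: "(f has_derivative D x) (at x)" for x using d[of x] by (simp add: D_def frechet_derivative_works)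
  have D0: "D x h = 0" if "x \<notin> ?S" for x h
  proof -
    have "((\<lambda>x. 0) has_derivative (\<lambda>h. 0)) (at x)" by simp
    then have "(f has_derivative (\<lambda>h. 0)) (at x)"
    proof (rule has_derivative_transform_within_open)
      show "open (- ?S)" by auto
      show "x \<in> - ?S" using that by simp
      show "0 = f y" if "y \<in> - ?S" for y
        using that set_mp[OF closure_subset, of y "{x. f x \<noteq> 0}"] by auto
    qed
    from has_derivative_unique[OF this D] have "(\<lambda>h. 0) = D x" .
    from fun_cong[OF this, of h] show ?thesis by simp
  qed
  have "\<forall>b\<in>Basis. \<exists>M. 0 \<le> M \<and> (\<forall>x. \<bar>D x b\<bar> \<le> M)"
  proof
    fix b :: 'a assume b: "b \<in> Basis"
    have "compact ((\<lambda>x. D x b) ` ?S)"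
      unfolding D_def by (intro compact_continuous_image S continuous_on_subset[OF c[OF b] subset_UNIV])
    from compact_imp_bounded[OF this] obtain M where M: "0 < M" "\<And>y. y \<in> (\<lambda>x. D x b) ` ?S \<Longrightarrow> norm y \<le> M"
      unfolding bounded_pos by blast
    have "\<bar>D x b\<bar> \<le> M" for x
      using M D0[of x b] by (cases "x \<in> ?S") auto
    then show "\<exists>M. 0 \<le> M \<and> (\<forall>x. \<bar>D x b\<bar> \<le> M)" using M(1) by (intro exI[of _ M]) auto
  qed
  then obtain M where M: "\<And>b. b \<in> Basis \<Longrightarrow> 0 \<le> M b" "\<And>b x. b \<in> Basis \<Longrightarrow> \<bar>D x b\<bar> \<le> M b" by metis
  have bound: "\<bar>D x h\<bar> \<le> (\<Sum>b\<in>Basis. M b) * norm h" for x h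
  proof -
    interpret linear "D x" using D has_derivative_linear by blast
    have "D x h = D x (\<Sum>b\<in>Basis. (h \<bullet> b) *\<^sub>R b)" by (simp add: euclidean_representation)
    also have "\<dots> = (\<Sum>b\<in>Basis. (h \<bullet> b) * D x b)" by (simp add: sum scale)
    finally have "\<bar>D x h\<bar> \<le> (\<Sum>b\<in>Basis. \<bar>(h \<bullet> b) * D x b\<bar>)" by (metis sum_abs)
    also have "\<dots> \<le> (\<Sum>b\<in>Basis. norm h * M b)"
      unfolding abs_mult using M by (intro sum_mono mult_mono Basis_le_norm) auto
    also have "\<dots> = (\<Sum>b\<in>Basis. M b) * norm h" by (simp add: sum_distrib_left mult.commute)
    finally show ?thesis .
  qed
  have "\<bar>f x - f y\<bar> \<le> (\<Sum>b\<in>Basis. M b) * norm (x - y)" for x y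
  proof -
    have "norm (f x - f y) \<le> (\<Sum>b\<in>Basis. M b) * norm (x - y)"
      by (rule differentiable_bound[of UNIV f D]) (use D bound in \<open>auto intro!: onorm_le\<close>)
    then show ?thesis by simp
  qed
  then show thesis by (rule that)
qed

section \<open>Existence of smooth bump functions\<close>

definition exp_recip :: "nat \<Rightarrow> real \<Rightarrow> real" where
  "exp_recip j t = (if 0 < t then exp (- inverse t) * inverse t ^ j else 0)"

lemma power_div_fact_le_exp: "0 \<le> x \<Longrightarrow> x ^ n / fact n \<le> exp x" for x :: real
proof -
  assume x: "0 \<le> x"
  have "(\<Sum>k\<in>{n}. x ^ k /\<^sub>R fact k) \<le> (\<Sum>k. x ^ k /\<^sub>R fact k)"
    using x sums_summable[OF exp_converges[of x]] by (intro sum_le_suminf) auto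
  then show ?thesis by (simp add: exp_def divide_inverse mult.commute)
qed

text \<open>The term of order j + 2 in the series of exp(1/t) beats the factor t^(-j) with two
  powers of t to spare. These two powers make the difference quotient at 0 tend to 0.\<close>

lemma exp_recip_le: "\<bar>exp_recip j t\<bar> \<le> fact (j + 2) * t\<^sup>2"
proof (cases "0 < t")
  case True
  have "inverse t ^ (j + 2) / fact (j + 2) \<le> exp (inverse t)"
    using True by (intro power_div_fact_le_exp) simp
  then have "inverse t ^ (j + 2) \<le> fact (j + 2) * exp (inverse t)"
    by (simp add: pos_divide_le_eq mult.commute)
  then have "inverse t ^ (j + 2) * (exp (- inverse t) * t\<^sup>2) \<le> fact (j + 2) * exp (inverse t) * (exp (- inverse t) * t\<^sup>2)"
    by (intro mult_right_mono) auto
  also have "\<dots> = fact (j + 2) * t\<^sup>2 * exp (inverse t + - inverse t)" unfolding exp_add by (simp only: ac_simps)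
  also have "\<dots> = fact (j + 2) * t\<^sup>2" by simp
  also have "inverse t ^ (j + 2) * (exp (- inverse t) * t\<^sup>2) = \<bar>exp_recip j t\<bar>"
    using True by (simp add: exp_recip_def power_add power2_eq_square) (simp add: field_simps)
  finally show ?thesis .
qed (simp add: exp_recip_def)

text \<open>The reason for the index \<open>j\<close>: differentiating exp(-1/t) t^(-j) yields a
  combination of members of the same family. One formula thus covers all orders, and the gluing with
  0 at t = 0 has to be checked only once.\<close>

lemma exp_recip_has_derivative:
  "(exp_recip j has_real_derivative (exp_recip (j + 2) t - real j * exp_recip (j + 1) t)) (at t)"
proof -
  consider "0 < t" | "t = 0" | "t < 0" by linarith
  then show ?thesis
  proof cases
    case 1
    have "((\<lambda>t. exp (- inverse t) * inverse t ^ j) has_real_derivative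
        (exp_recip (j + 2) t - real j * exp_recip (j + 1) t)) (at t)"
    proof -
      have d: "((\<lambda>y. exp (- y) * y ^ j) has_real_derivative
          (exp (- y) * (real j * y ^ (j - 1)) - exp (- y) * y ^ j)) (at y)" for y :: real
        by (auto intro!: derivative_eq_intros)
      have "((\<lambda>t. exp (- inverse t) * inverse t ^ j) has_real_derivative
          (exp (- inverse t) * (real j * inverse t ^ (j - 1)) - exp (- inverse t) * inverse t ^ j) * (- (inverse t ^ Suc (Suc 0)))) (at t)"
        using 1 by (intro DERIV_chain2[OF d DERIV_inverse]) simp
      moreover have "(exp (- inverse t) * (real j * inverse t ^ (j - 1)) - exp (- inverse t) * inverse t ^ j) * (- (inverse t ^ Suc (Suc 0)))
          = exp_recip (j + 2) t - real j * exp_recip (j + 1) t"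
        \<comment> \<open>The natural number \<open>j - 1\<close> is truncated at
          \<open>j = 0\<close>, where the factor \<open>real j\<close> removes its term.\<close>
        using 1 by (cases j) (simp_all add: exp_recip_def algebra_simps)
      ultimately show ?thesis by simp
    qed
    then show ?thesis
      by (rule has_field_derivative_transform_within_open[of _ _ _ "{0<..}"]) (use 1 in \<open>auto simp: exp_recip_def\<close>)
  next
    case 2
    have "((\<lambda>h. (exp_recip j (0 + h) - exp_recip j 0) / h) \<longlongrightarrow> 0) (at 0)"
    proof (rule Lim_null_comparison)
      have le: "norm ((exp_recip j (0 + h) - exp_recip j 0) / h) \<le> fact (j + 2) * \<bar>h\<bar>" for h
        using exp_recip_le[of j h] by (cases "h = 0") (auto simp: exp_recip_def[of _ 0] power2_eq_square divide_le_eq abs_mult mult.assoc)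
      show "\<forall>\<^sub>F h in at 0. norm ((exp_recip j (0 + h) - exp_recip j 0) / h) \<le> fact (j + 2) * \<bar>h\<bar>"
        using le by simp
      show "((\<lambda>h. fact (j + 2) * \<bar>h\<bar>) \<longlongrightarrow> 0) (at (0::real))"
        by (rule tendsto_eq_intros refl | simp)+
    qed
    then show ?thesis using 2 by (simp add: DERIV_def exp_recip_def[of _ 0])
  next
    case 3
    have "((\<lambda>t. 0) has_real_derivative 0) (at t)" by simp
    then have "(exp_recip j has_real_derivative 0) (at t)"
      by (rule has_field_derivative_transform_within_open[of _ _ _ "{..<0}"]) (use 3 in \<open>auto simp: exp_recip_def\<close>)
    then show ?thesis using 3 by (simp add: exp_recip_def)
  qed
qed

text \<open>An algebra of functions that contains a bump function and is closed under partial derivatives.\<close>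

inductive_set bump_algebra :: "'a::euclidean_space \<Rightarrow> real \<Rightarrow> ('a \<Rightarrow> real) set" for c r where
  const: "(\<lambda>x. a) \<in> bump_algebra c r"
| inner: "(\<lambda>x. x \<bullet> b) \<in> bump_algebra c r"
| bump: "(\<lambda>x. exp_recip j (r\<^sup>2 - (x - c) \<bullet> (x - c))) \<in> bump_algebra c r"
| add: "f \<in> bump_algebra c r \<Longrightarrow> g \<in> bump_algebra c r \<Longrightarrow> (\<lambda>x. f x + g x) \<in> bump_algebra c r"
| mult: "f \<in> bump_algebra c r \<Longrightarrow> g \<in> bump_algebra c r \<Longrightarrow> (\<lambda>x. f x * g x) \<in> bump_algebra c r"

lemma bump_algebra_derivative:
  assumes "f \<in> bump_algebra c r"
  shows "\<exists>F. (\<forall>x. (f has_derivative F x) (at x)) \<and> (\<forall>b. (\<lambda>x. F x b) \<in> bump_algebra c r)"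
  using assms
proof induction
  case (const a)
  then show ?case by (intro exI[of _ "\<lambda>x h. 0"]) (auto intro: bump_algebra.intros)
next
  case (inner b)
  then show ?case by (intro exI[of _ "\<lambda>x h. h \<bullet> b"])
      (auto intro!: derivative_eq_intros bump_algebra.intros)
next
  case (bump j)
  let ?q = "\<lambda>x. r\<^sup>2 - (x - c) \<bullet> (x - c)"
  \<comment> \<open>Written with sums, products and constants only, without subtraction, so that its
    shape matches the introduction rules of \<open>bump_algebra\<close>.\<close>
  let ?F = "\<lambda>x h. (exp_recip (j + 2) (?q x) + (- real j) * exp_recip (j + 1) (?q x)) * ((- 2) * (x \<bullet> h + - (c \<bullet> h)))"
  have "((\<lambda>x. exp_recip j (?q x)) has_derivative ?F x) (at x)" for x
  proof -
    have "(?q has_derivative (\<lambda>h. - (2 * ((x - c) \<bullet> h)))) (at x)"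
      by (auto intro!: derivative_eq_intros simp: inner_commute)
    from has_derivative_compose[OF this exp_recip_has_derivative[unfolded has_field_derivative_def]]
    show ?thesis
      by (rule has_derivative_eq_rhs) (auto simp: fun_eq_iff inner_diff_left algebra_simps)
  qed
  moreover have "(\<lambda>x. ?F x h) \<in> bump_algebra c r" for h
    by (intro bump_algebra.intros)
  ultimately show ?case by (intro exI[of _ ?F] conjI allI)
next
  case (add f g)
  then obtain F G where F: "\<And>x. (f has_derivative F x) (at x)" "\<And>b. (\<lambda>x. F x b) \<in> bump_algebra c r"
    and G: "\<And>x. (g has_derivative G x) (at x)" "\<And>b. (\<lambda>x. G x b) \<in> bump_algebra c r" by metis
  show ?case
    by (intro exI[of _ "\<lambda>x h. F x h + G x h"] conjI allI has_derivative_add bump_algebra.add F G)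
next
  case (mult f g)
  then obtain F G where F: "\<And>x. (f has_derivative F x) (at x)" "\<And>b. (\<lambda>x. F x b) \<in> bump_algebra c r"
    and G: "\<And>x. (g has_derivative G x) (at x)" "\<And>b. (\<lambda>x. G x b) \<in> bump_algebra c r" by metis
  show ?case
    by (intro exI[of _ "\<lambda>x h. f x * G x h + F x h * g x"] conjI allI has_derivative_mult
        bump_algebra.add bump_algebra.mult F G mult.hyps)
qed

lemma bump_algebra_Ck: "f \<in> bump_algebra c r \<Longrightarrow> Ck k f"
proof (induction k arbitrary: f)
  case (0 f)
  then obtain F where "\<And>x. (f has_derivative F x) (at x)" using bump_algebra_derivative by metis
  then show ?case by (auto intro!: continuous_at_imp_continuous_on has_derivative_continuous)
next
  case (Suc k f)
  then obtain F where F: "\<And>x. (f has_derivative F x) (at x)" "\<And>b. (\<lambda>x. F x b) \<in> bump_algebra c r"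
    using bump_algebra_derivative by metis
  have "frechet_derivative f (at x) = F x" for x using F(1) by (metis frechet_derivative_at)
  then show ?case using F Suc.IH by (auto simp: differentiable_def)
qed

text \<open>The function is exp(-1/t) at t = r^2 - |x-c|^2. It is nonzero exactly on the open ball,
  so its closed support is \<open>cball c r\<close>, and \<open>r\<close> is chosen to keep this
  ball inside \<Omega>.\<close>

lemma test_functions_bump:
  fixes \<Omega> :: "'a::euclidean_space set"
  assumes "open \<Omega>" "c \<in> \<Omega>"
  obtains \<phi> r where "\<phi> \<in> test_functions \<Omega>" "0 < r" "\<And>x. x \<in> ball c r \<Longrightarrow> \<phi> x \<noteq> 0"
proof -
  obtain r where r: "0 < r" "cball c r \<subseteq> \<Omega>" using assms open_contains_cball by blast
  define \<phi> where "\<phi> x = exp_recip 0 (r\<^sup>2 - (x - c) \<bullet> (x - c))" for x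
  have nz: "\<phi> x \<noteq> 0 \<longleftrightarrow> x \<in> ball c r" for x
  proof -
    have "\<phi> x \<noteq> 0 \<longleftrightarrow> (norm (x - c))\<^sup>2 < r\<^sup>2"
      by (simp add: \<phi>_def exp_recip_def power2_norm_eq_inner)
    also have "\<dots> \<longleftrightarrow> norm (x - c) < r" using abs_le_square_iff[of r "norm (x - c)"] r(1) by (metis abs_norm_cancel abs_of_pos not_le)
    finally show ?thesis by (simp add: dist_norm norm_minus_commute)
  qed
  have "closure {x. \<phi> x \<noteq> 0} = cball c r" unfolding nz Collect_mem_eq using r by simp
  moreover have "compact (cball c r)" by (rule compact_cball)
  moreover have "\<forall>k. Ck k \<phi>"
    unfolding \<phi>_def by (intro allI bump_algebra_Ck[OF bump_algebra.bump])
  ultimately have "\<phi> \<in> test_functions \<Omega>" using r(2) by (simp only: test_functions_def mem_Collect_eq simp_thms)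
  then show thesis using r(1) nz by (intro that) auto
qed

section \<open>The Gagliardo seminorm as a norm\<close>

text \<open>Splitting the kernel between the two factors turns the Gagliardo seminorm into an \<open>L^p\<close> norm on
  the product space.\<close>

definition gag_quot :: "real \<Rightarrow> real \<Rightarrow> ('a::euclidean_space \<Rightarrow> real) \<Rightarrow> 'a \<times> 'a \<Rightarrow> real" where
  "gag_quot p s w = (\<lambda>(x, y). (w x - w y) / norm (x - y) powr (real DIM('a) / p + s))"

lemma gag_quot_diff: "gag_quot p s (\<lambda>x. u x - v x) z = gag_quot p s u z - gag_quot p s v z"
  by (cases z) (simp add: gag_quot_def diff_divide_distrib)

lemma gagliardo_integrand_eq:
  assumes "0 < p"
  shows "gagliardo_integrand p s w z = \<bar>gag_quot p s w z\<bar> powr p"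
proof (cases z)
  case (Pair x y)
  have "(real DIM('a) / p + s) * p = real DIM('a) + p * s" using assms by (simp add: field_simps)
  then show ?thesis using Pair
    by (simp add: gagliardo_integrand_def gag_quot_def powr_divide powr_powr)
qed

lemma gagliardo_eq_Lp_norm: "0 < p \<Longrightarrow> gagliardo p s w = Lp_norm lebesgue p (gag_quot p s w)"
  by (simp add: gagliardo_def Lp_norm_def gagliardo_integrand_eq)

lemma measurable_norm_diff_powr:
  "(\<lambda>z :: 'a \<times> 'a. norm (fst z - snd z) powr c) \<in> borel_measurable (lebesgue :: ('a::euclidean_space \<times> 'a) measure)"
proof -
  have "(\<lambda>z :: 'a \<times> 'a. norm (fst z - snd z) powr c) \<in> borel_measurable borel"
    by (rule measurable_compose[of "\<lambda>z. norm (fst z - snd z)" _ borel], rule borel_measurable_continuous_onI)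
      (intro continuous_intros, measurable)
  then show ?thesis by (intro measurable_completion) simp
qed

lemma measurable_gag_quot:
  fixes w :: "'a::euclidean_space \<Rightarrow> real"
  assumes "w \<in> borel_measurable lebesgue"
  shows "gag_quot p s w \<in> borel_measurable lebesgue"
  using measurable_lebesgue_fst[OF assms, where 'b = 'a] measurable_lebesgue_snd[OF assms, where 'a = 'a]
    measurable_norm_diff_powr[where 'a = 'a]
  by (simp add: gag_quot_def case_prod_unfold)

lemma Wsp_iff: "0 < p \<Longrightarrow> w \<in> Wsp p s \<longleftrightarrow> in_Lp lebesgue p w \<and> in_Lp lebesgue p (gag_quot p s w)"
  using measurable_gag_quot[of w p s]
  by (auto simp: Wsp_def in_Lp_def gagliardo_integrand_eq cong: Bochner_Integration.integrable_cong)

text \<open>The weights combine because (N/p + s)(p-1) + (N/p + s) = N + ps. On the diagonal both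
  sides are 0.\<close>

lemma sgn_powr_gag_quot_mult:
  fixes v \<xi> :: "'a::euclidean_space \<Rightarrow> real"
  assumes "0 < p"
  shows "sgn_powr p (gag_quot p s v (x, y)) * gag_quot p s \<xi> (x, y) =
    sgn_powr p (v x - v y) * (\<xi> x - \<xi> y) / norm (x - y) powr (real DIM('a) + p * s)"
proof (cases "x = y")
  case False
  let ?e = "real DIM('a) / p + s"
  have "sgn_powr p (gag_quot p s v (x, y)) = sgn_powr p (v x - v y) / norm (x - y) powr (?e * (p - 1))"
    unfolding gag_quot_def prod.case by (subst sgn_powr_divide_pos) (use False in \<open>auto simp: powr_powr\<close>)
  moreover have "?e * (p - 1) + ?e = real DIM('a) + p * s" using assms by (simp add: field_simps)
  then have "norm (x - y) powr (?e * (p - 1)) * norm (x - y) powr ?e = norm (x - y) powr (real DIM('a) + p * s)"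
    by (metis powr_add)
  ultimately show ?thesis by (simp add: gag_quot_def)
qed (simp add: gag_quot_def)

lemma dF_eq:
  assumes "0 < p"
  shows "dF p s \<Omega> h v \<xi> = (LINT z|lebesgue. sgn_powr p (gag_quot p s v z) * gag_quot p s \<xi> z)
    - (LINT x|lebesgue_on \<Omega>. h x * \<xi> x)"
proof -
  have "(\<lambda>(x, y). sgn_powr p (v x - v y) * (\<xi> x - \<xi> y) / norm (x - y) powr (real DIM('a) + p * s))
      = (\<lambda>z. sgn_powr p (gag_quot p s v z) * gag_quot p s \<xi> z)"
    by (auto simp: fun_eq_iff sgn_powr_gag_quot_mult[OF assms])
  then show ?thesis unfolding dF_def by (simp only:)
qed

lemma W0_Wsp: "w \<in> W0 p s \<Omega> \<Longrightarrow> w \<in> Wsp p s"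
  by (simp add: W0_def)

lemma W0_in_Lp:
  assumes "w \<in> W0 p s \<Omega>" "0 < p"
  shows "in_Lp lebesgue p w" "in_Lp lebesgue p (gag_quot p s w)"
  using assms W0_Wsp Wsp_iff by blast+

lemma W0_approx:
  assumes "w \<in> W0 p s \<Omega>" "0 < p" "0 < \<epsilon>"
  obtains \<phi> where "\<phi> \<in> test_functions \<Omega>" "Lp_norm lebesgue p (\<lambda>x. w x - \<phi> x) < \<epsilon>"
    "Lp_norm lebesgue p (\<lambda>z. gag_quot p s w z - gag_quot p s \<phi> z) < \<epsilon>"
proof -
  obtain \<phi> where \<phi>: "\<phi> \<in> test_functions \<Omega>"
    "Lp_norm lebesgue p (\<lambda>x. w x - \<phi> x) + gagliardo p s (\<lambda>x. w x - \<phi> x) < \<epsilon>"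
    using assms by (auto simp: W0_def)
  from \<phi>(2) have "Lp_norm lebesgue p (\<lambda>x. w x - \<phi> x) < \<epsilon>" "gagliardo p s (\<lambda>x. w x - \<phi> x) < \<epsilon>"
    using Lp_norm_nonneg[of lebesgue p "\<lambda>x. w x - \<phi> x"] Lp_norm_nonneg[of lebesgue p "gag_quot p s (\<lambda>x. w x - \<phi> x)"]
    unfolding gagliardo_eq_Lp_norm[OF assms(2)] by linarith+
  with \<phi>(1) show thesis
    unfolding gagliardo_eq_Lp_norm[OF assms(2)] gag_quot_diff by (rule that)
qed

lemma in_Lp_bounded_support:
  fixes f :: "'a::euclidean_space \<Rightarrow> real"
  assumes "f \<in> borel_measurable lebesgue" "\<And>x. \<bar>f x\<bar> \<le> M" "compact K" "\<And>x. x \<notin> K \<Longrightarrow> f x = 0" "0 < q"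
  shows "in_Lp lebesgue q f"
  unfolding in_Lp_def
proof
  have "integrable lebesgue (\<lambda>x. M powr q * indicator K x)"
    using assms(3) emeasure_compact_finite[OF assms(3)]
    by (intro integrable_mult_right integrable_real_indicator) (auto simp: compact_imp_closed)
  then show "integrable lebesgue (\<lambda>x. \<bar>f x\<bar> powr q)"
  proof (rule Bochner_Integration.integrable_bound)
    show "(\<lambda>x. \<bar>f x\<bar> powr q) \<in> borel_measurable lebesgue" using assms(1) by measurable
    have "\<bar>f x\<bar> powr q \<le> M powr q * indicator K x" for x
      using assms(2)[of x] assms(4)[of x] assms(5) by (cases "x \<in> K") (auto intro: powr_mono2)
    then show "AE x in lebesgue. norm (\<bar>f x\<bar> powr q) \<le> norm (M powr q * indicator K x)"
      by (simp add: indicator_def)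
  qed
qed fact

text \<open>The approximation clause is met by \<phi> itself; the content is the finiteness of the
  seminorm, for which the Lipschitz bound and the compact support are used.\<close>

lemma test_functions_W0:
  assumes p: "0 < p" and s: "0 < s" "s < 1" and \<phi>: "\<phi> \<in> test_functions \<Omega>"
  shows "\<phi> \<in> W0 p s \<Omega>"
proof -
  let ?K = "closure {x. \<phi> x \<noteq> 0}"
  have K: "compact ?K" by (rule test_functionsD[OF \<phi>])
  have K0: "\<phi> x = 0" if "x \<notin> ?K" for x
    using that set_mp[OF closure_subset, of x "{x. \<phi> x \<noteq> 0}"] by auto
  have cont: "continuous_on UNIV \<phi>" by (rule test_functions_continuous[OF \<phi>])
  obtain M where M: "\<And>x. \<bar>\<phi> x\<bar> \<le> M" using test_functions_bounded[OF \<phi>] by blast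
  obtain L where L: "\<And>x y. \<bar>\<phi> x - \<phi> y\<bar> \<le> L * norm (x - y)" using test_functions_Lipschitz[OF \<phi>] by blast
  have "\<phi> \<in> borel_measurable lebesgue"
    by (intro measurable_completion) (simp add: borel_measurable_continuous_onI cont)
  then have "in_Lp lebesgue p \<phi>" by (rule in_Lp_bounded_support[OF _ M K K0 p])
  moreover have "integrable lebesgue (gagliardo_integrand p s \<phi>)"
    by (rule Lipschitz_bounded_support_gagliardo[OF p s L M compact_imp_bounded[OF K] K0 cont])
  ultimately have "\<phi> \<in> Wsp p s" by (simp add: Wsp_def)
  moreover have "Lp_norm lebesgue p (\<lambda>x. \<phi> x - \<phi> x) + gagliardo p s (\<lambda>x. \<phi> x - \<phi> x) = 0"
    using p by (simp add: Lp_norm_def gagliardo_eq_Lp_norm gag_quot_def case_prod_unfold)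
  ultimately show ?thesis unfolding W0_def using \<phi> by (auto intro!: bexI[of _ \<phi>])
qed

lemma W0_diff:
  assumes p: "1 \<le> p" and s: "0 < s" "s < 1" and u: "u \<in> W0 p s \<Omega>" and v: "v \<in> W0 p s \<Omega>"
  shows "(\<lambda>x. u x - v x) \<in> W0 p s \<Omega>"
proof -
  have p0: "0 < p" using p by simp
  have "in_Lp lebesgue p (gag_quot p s (\<lambda>x. u x - v x))"
    using in_Lp_diff[OF W0_in_Lp(2)[OF u p0] W0_in_Lp(2)[OF v p0] p0] by (simp only: gag_quot_diff[abs_def])
  then have "(\<lambda>x. u x - v x) \<in> Wsp p s"
    using in_Lp_diff[OF W0_in_Lp(1)[OF u p0] W0_in_Lp(1)[OF v p0] p0] by (simp add: Wsp_iff[OF p0])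
  moreover have "\<exists>\<phi>\<in>test_functions \<Omega>. Lp_norm lebesgue p (\<lambda>x. u x - v x - \<phi> x) + gagliardo p s (\<lambda>x. u x - v x - \<phi> x) < \<epsilon>"
    if \<epsilon>: "0 < \<epsilon>" for \<epsilon>
  proof -
    \<comment> \<open>The quasi-triangle inequality costs a factor 4, and 4 (\<epsilon>/16 +
      \<epsilon>/16) = \<epsilon>/2 for each of the two norms.\<close>
    have e: "0 < \<epsilon> / 16" using \<epsilon> by simp
    obtain \<phi> where \<phi>: "\<phi> \<in> test_functions \<Omega>" "Lp_norm lebesgue p (\<lambda>x. u x - \<phi> x) < \<epsilon> / 16"
      "Lp_norm lebesgue p (\<lambda>z. gag_quot p s u z - gag_quot p s \<phi> z) < \<epsilon> / 16"
      using W0_approx[OF u p0 e] .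
    obtain \<psi> where \<psi>: "\<psi> \<in> test_functions \<Omega>" "Lp_norm lebesgue p (\<lambda>x. v x - \<psi> x) < \<epsilon> / 16"
      "Lp_norm lebesgue p (\<lambda>z. gag_quot p s v z - gag_quot p s \<psi> z) < \<epsilon> / 16"
      using W0_approx[OF v p0 e] .
    note uL = W0_in_Lp[OF u p0] and vL = W0_in_Lp[OF v p0]
      and \<phi>L = W0_in_Lp[OF test_functions_W0[OF p0 s \<phi>(1)] p0]
      and \<psi>L = W0_in_Lp[OF test_functions_W0[OF p0 s \<psi>(1)] p0]
    have "Lp_norm lebesgue p (\<lambda>x. (u x - \<phi> x) + (\<psi> x - v x)) \<le>
        4 * (Lp_norm lebesgue p (\<lambda>x. u x - \<phi> x) + Lp_norm lebesgue p (\<lambda>x. \<psi> x - v x))"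
      by (intro Lp_norm_add_quasi in_Lp_diff uL vL \<phi>L \<psi>L p p0)
    also have "\<dots> < 4 * (\<epsilon> / 16 + \<epsilon> / 16)"
      using \<phi>(2) \<psi>(2) unfolding Lp_norm_minus_commute[of lebesgue p \<psi> v] by simp
    finally have 1: "Lp_norm lebesgue p (\<lambda>x. u x - v x - (\<phi> x - \<psi> x)) < \<epsilon> / 2" by (simp add: algebra_simps)
    have "Lp_norm lebesgue p (\<lambda>x. (gag_quot p s u x - gag_quot p s \<phi> x) + (gag_quot p s \<psi> x - gag_quot p s v x)) \<le>
        4 * (Lp_norm lebesgue p (\<lambda>x. gag_quot p s u x - gag_quot p s \<phi> x) + Lp_norm lebesgue p (\<lambda>x. gag_quot p s \<psi> x - gag_quot p s v x))"
      by (intro Lp_norm_add_quasi in_Lp_diff uL vL \<phi>L \<psi>L p p0)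
    also have "\<dots> < 4 * (\<epsilon> / 16 + \<epsilon> / 16)"
      using \<phi>(3) \<psi>(3) unfolding Lp_norm_minus_commute[of lebesgue p "gag_quot p s \<psi>"] by simp
    also have "(\<lambda>x. (gag_quot p s u x - gag_quot p s \<phi> x) + (gag_quot p s \<psi> x - gag_quot p s v x)) =
        gag_quot p s (\<lambda>x. u x - v x - (\<phi> x - \<psi> x))"
      by (simp add: fun_eq_iff gag_quot_diff)
    finally have 2: "gagliardo p s (\<lambda>x. u x - v x - (\<phi> x - \<psi> x)) < \<epsilon> / 2"
      by (simp add: gagliardo_eq_Lp_norm[OF p0])
    show ?thesis
      by (rule bexI[OF _ test_functions_diff[OF \<phi>(1) \<psi>(1)]]) (use 1 2 in linarith)
  qed
  ultimately show ?thesis unfolding W0_def by simp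
qed

text \<open>Test functions vanish off \<Omega>, so there |w|^p coincides with |w - \<phi>|^p, whose
  integral is arbitrarily small.\<close>

lemma W0_eq_0_outside:
  fixes \<Omega> :: "'a::euclidean_space set"
  assumes p: "0 < p" and s: "0 < s" "s < 1" and \<Omega>: "open \<Omega>" and w: "w \<in> W0 p s \<Omega>"
  shows "AE x in lebesgue. x \<notin> \<Omega> \<longrightarrow> w x = 0"
proof -
  have wL: "in_Lp lebesgue p w" by (rule W0_in_Lp[OF w p])
  have \<Omega>m: "- \<Omega> \<in> sets lebesgue" using \<Omega> by auto
  define f where "f x = \<bar>w x\<bar> powr p * indicator (- \<Omega>) x" for x
  have fint: "integrable lebesgue f"
    unfolding f_def using integrable_real_mult_indicator[OF \<Omega>m in_Lp_integrable[OF wL]] by (simp add: mult.commute)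
  have small: "(LINT x|lebesgue. f x) \<le> \<epsilon> powr p" if \<epsilon>: "0 < \<epsilon>" for \<epsilon>
  proof -
    obtain \<phi> where \<phi>: "\<phi> \<in> test_functions \<Omega>" "Lp_norm lebesgue p (\<lambda>x. w x - \<phi> x) < \<epsilon>"
      using W0_approx[OF w p \<epsilon>] .
    have \<phi>0: "\<phi> x = 0" if "x \<notin> \<Omega>" for x
      using that test_functionsD(3)[OF \<phi>(1)] set_mp[OF closure_subset, of x "{x. \<phi> x \<noteq> 0}"] by auto
    have "(LINT x|lebesgue. f x) \<le> (LINT x|lebesgue. \<bar>w x - \<phi> x\<bar> powr p)"
    proof (rule integral_mono[OF fint])
      show "integrable lebesgue (\<lambda>x. \<bar>w x - \<phi> x\<bar> powr p)"
        by (rule in_Lp_integrable[OF in_Lp_diff[OF wL W0_in_Lp(1)[OF test_functions_W0[OF p s \<phi>(1)] p] p]])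
      show "f x \<le> \<bar>w x - \<phi> x\<bar> powr p" for x
        using \<phi>0[of x] by (cases "x \<in> \<Omega>") (simp_all add: f_def)
    qed
    also have "\<dots> = Lp_norm lebesgue p (\<lambda>x. w x - \<phi> x) powr p" using p by (simp add: Lp_norm_powr)
    also have "\<dots> \<le> \<epsilon> powr p" using \<phi>(2) p by (intro powr_mono2 Lp_norm_nonneg) auto
    finally show ?thesis .
  qed
  have "(LINT x|lebesgue. f x) \<le> 0"
  proof (rule ccontr)
    assume "\<not> ?thesis"
    then have pos: "0 < (LINT x|lebesgue. f x) / 2" by simp
    \<comment> \<open>This \<epsilon> has half of the integral as its p-th power.\<close>
    from small[of "((LINT x|lebesgue. f x) / 2) powr (1 / p)"] pos p
    have "(LINT x|lebesgue. f x) \<le> (LINT x|lebesgue. f x) / 2" by (simp add: powr_powr)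
    with pos show False by simp
  qed
  moreover have "0 \<le> (LINT x|lebesgue. f x)" by (simp add: f_def)
  ultimately have "(LINT x|lebesgue. f x) = 0" by simp
  moreover have "AE x in lebesgue. 0 \<le> f x" by (simp add: f_def)
  ultimately have "AE x in lebesgue. f x = 0"
    using integral_nonneg_eq_0_iff_AE[OF fint] by blast
  then show ?thesis by eventually_elim (auto simp: f_def)
qed

lemma integral_lebesgue_on_eq:
  fixes f :: "'a::euclidean_space \<Rightarrow> real"
  assumes "\<Omega> \<in> sets lebesgue"
  shows "(LINT x|lebesgue_on \<Omega>. f x) = (LINT x|lebesgue. indicator \<Omega> x * f x)"
    and "integrable (lebesgue_on \<Omega>) f \<longleftrightarrow> integrable lebesgue (\<lambda>x. indicator \<Omega> x * f x)"
  using integral_restrict_space[of \<Omega> lebesgue f] integrable_restrict_space[of \<Omega> lebesgue f] assms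
  by simp_all

lemma in_Lp_lebesgue_on:
  fixes f :: "'a::euclidean_space \<Rightarrow> real"
  assumes "in_Lp lebesgue q f" "\<Omega> \<in> sets lebesgue"
  shows "in_Lp (lebesgue_on \<Omega>) q f"
  using assms integrable_real_mult_indicator[OF assms(2) in_Lp_integrable[OF assms(1)]]
  by (auto simp: in_Lp_def integral_lebesgue_on_eq measurable_restrict_space1 mult.commute)

lemma Lp_norm_lebesgue_on_le:
  fixes f :: "'a::euclidean_space \<Rightarrow> real"
  assumes "in_Lp lebesgue q f" "\<Omega> \<in> sets lebesgue" "0 < q"
  shows "Lp_norm (lebesgue_on \<Omega>) q f \<le> Lp_norm lebesgue q f"
  unfolding Lp_norm_def integral_lebesgue_on_eq[OF assms(2)]
proof (intro powr_mono2 integral_mono)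
  show "integrable lebesgue (\<lambda>x. indicat_real \<Omega> x * \<bar>f x\<bar> powr q)"
    using integrable_real_mult_indicator[OF assms(2) in_Lp_integrable[OF assms(1)]] by (simp add: mult.commute)
qed (use assms in \<open>auto simp: in_Lp_def indicator_def\<close>)

section \<open>The fractional Poincare inequality\<close>

text \<open>No compactness is involved. Since \<open>w\<close> vanishes on a unit ball
  \<open>B\<close> outside \<Omega> and at bounded distance from it, |w x|^p = |w x - w y|^p for y
  in \<open>B\<close>, which is at most \<open>d\<close> times the Gagliardo integrand. Integrating
  over y in \<open>B\<close> produces |w x|^p times the volume \<open>m\<close>, whence the constant
  \<open>(d / m) powr (1 / p)\<close>.\<close>

lemma fractional_Poincare:
  fixes \<Omega> :: "'a::euclidean_space set"
  assumes p: "0 < p" and s: "0 < s" "s < 1" and \<Omega>: "open \<Omega>" "bounded \<Omega>"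
  shows "\<exists>C\<ge>0. \<forall>w\<in>W0 p s \<Omega>. Lp_norm (lebesgue_on \<Omega>) p w \<le> C * gagliardo p s w"
proof -
  obtain R where R: "0 < R" "\<And>x. x \<in> \<Omega> \<Longrightarrow> norm x \<le> R" using \<Omega>(2) unfolding bounded_pos by blast
  obtain b :: 'a where b: "b \<in> Basis" using nonempty_Basis by blast
  \<comment> \<open>With \<Omega> inside the ball of radius \<open>R\<close>, the centre at distance
    R + 2 leaves a gap: points of \<open>B\<close> have norm between R + 1 and R + 3.\<close>
  define a where "a = (R + 2) *\<^sub>R b"
  have a: "norm a = R + 2" using R b by (simp add: a_def)
  define B where "B = cball a 1"
  have Bout: "y \<notin> \<Omega>" and Bfar: "norm y \<le> R + 3" if "y \<in> B" for y
  proof -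
    have "norm (a - y) \<le> 1" using that by (simp add: B_def dist_norm)
    with norm_triangle_ineq2[of a y] norm_triangle_ineq2[of y a] norm_minus_commute[of a y] a
    have "R + 1 \<le> norm y" "norm y \<le> R + 3" by linarith+
    then show "y \<notin> \<Omega>" "norm y \<le> R + 3" using R(2)[of y] by auto
  qed
  define m where "m = measure lebesgue B"
  have m: "0 < m" using content_cball[of 1 a] by (simp add: m_def B_def)
  \<comment> \<open>A point of \<Omega> and a point of \<open>B\<close> are at most R + (R + 3)
    apart, so \<open>d\<close> bounds the denominator of the kernel.\<close>
  define d where "d = (2 * R + 3) powr (real DIM('a) + p * s)"
  have d: "0 < d" using R by (simp add: d_def)
  define C where "C = (d / m) powr (1 / p)"
  show ?thesis
  proof (intro exI[of _ C] conjI ballI)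
    show "0 \<le> C" by (simp add: C_def)
    fix w assume w: "w \<in> W0 p s \<Omega>"
    note wL = W0_in_Lp[OF w p]
    have w0: "AE z in lebesgue. snd z \<notin> \<Omega> \<longrightarrow> w (snd z) = 0"
      by (rule AE_lebesgue_snd[OF W0_eq_0_outside[OF p s \<Omega>(1) w]])
    define k :: "'a \<times> 'a \<Rightarrow> real" where "k z = indicator \<Omega> (fst z) * \<bar>w (fst z)\<bar> powr p * indicator B (snd z)" for z
    have km: "k \<in> borel_measurable lebesgue"
    proof -
      have [measurable]: "w \<in> borel_measurable lebesgue" using wL by (simp add: in_Lp_def)
      have [measurable]: "\<Omega> \<in> sets lebesgue" "B \<in> sets lebesgue" using \<Omega>(1) by (auto simp: B_def)
      have "(\<lambda>x. indicator \<Omega> x * \<bar>w x\<bar> powr p) \<in> borel_measurable lebesgue" "(indicator B :: 'a \<Rightarrow> real) \<in> borel_measurable lebesgue"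
        by measurable
      from measurable_lebesgue_fst[OF this(1), where 'b = 'a] measurable_lebesgue_snd[OF this(2), where 'a = 'a]
      show ?thesis unfolding k_def[abs_def] by measurable
    qed
    have ptw: "AE z in lebesgue. k z \<le> d * gagliardo_integrand p s w z"
      using w0
    proof eventually_elim
      case (elim z)
      obtain x y where z: "z = (x, y)" by (cases z)
      show ?case
      proof (cases "x \<in> \<Omega> \<and> y \<in> B")
        case True
        then have y: "w y = 0" "norm y \<le> R + 3" using elim Bout Bfar by (auto simp: z)
        have xy: "norm (x - y) \<le> 2 * R + 3" using True R(2)[of x] y norm_triangle_ineq4[of x y] by auto
        have "x \<noteq> y" using True Bout by auto
        then have "0 < norm (x - y) powr (real DIM('a) + p * s)" by simp
        moreover have "norm (x - y) powr (real DIM('a) + p * s) \<le> d"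
          unfolding d_def using p s xy by (intro powr_mono2) auto
        ultimately have "\<bar>w x\<bar> powr p \<le> d * (\<bar>w x\<bar> powr p / norm (x - y) powr (real DIM('a) + p * s))"
          using mult_left_mono[of "norm (x - y) powr (real DIM('a) + p * s)" d "\<bar>w x\<bar> powr p"]
          by (simp add: pos_le_divide_eq mult.commute)
        then show ?thesis using True y by (simp add: k_def z gagliardo_integrand_def)
      next
        case False
        then have "k z = 0" by (auto simp: k_def z)
        then show ?thesis using d by (simp add: gagliardo_integrand_def z)
      qed
    qed
    have Gint: "integrable lebesgue (\<lambda>z. d * gagliardo_integrand p s w z)"
      using W0_Wsp[OF w] by (simp add: Wsp_def)
    have kint: "integrable lebesgue k"
    proof (rule Bochner_Integration.integrable_bound[OF Gint km])
      have "0 \<le> k z" for z by (simp add: k_def)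
      then show "AE z in lebesgue. norm (k z) \<le> norm (d * gagliardo_integrand p s w z)"
        using ptw by (auto elim!: eventually_mono)
    qed
    have "m * (LINT x|lebesgue_on \<Omega>. \<bar>w x\<bar> powr p) = (LINT x|lebesgue. LINT y|lebesgue. k (x, y))"
    proof -
      have "(LINT y|lebesgue. k (x, y)) = m * (indicator \<Omega> x * \<bar>w x\<bar> powr p)" for x
        by (simp add: k_def m_def B_def)
      then show ?thesis using \<Omega>(1) by (simp add: integral_lebesgue_on_eq)
    qed
    also have "\<dots> = (LINT z|lebesgue. k z)" by (rule lebesgue_Fubini(2)[OF kint, symmetric])
    also have "\<dots> \<le> (LINT z|lebesgue. d * gagliardo_integrand p s w z)"
      by (rule integral_mono_AE[OF kint Gint ptw])
    also have "\<dots> = d * gagliardo p s w powr p"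
      using p by (simp add: gagliardo_eq_Lp_norm Lp_norm_powr gagliardo_integrand_eq)
    finally have "(LINT x|lebesgue_on \<Omega>. \<bar>w x\<bar> powr p) \<le> d / m * gagliardo p s w powr p"
      using m by (simp add: field_simps)
    then have "Lp_norm (lebesgue_on \<Omega>) p w powr p \<le> (C * gagliardo p s w) powr p"
      using p d m by (simp add: Lp_norm_powr C_def powr_mult powr_powr)
    then show "Lp_norm (lebesgue_on \<Omega>) p w \<le> C * gagliardo p s w"
      by (rule powr_le_powr_cancel[OF _ p]) (simp add: C_def gagliardo_def)
  qed
qed

text \<open>The infimum is itself admissible. If the seminorm of \<open>w\<close> is positive, the
  quotient of the norms is a lower bound of all admissible constants; if it is zero, any single
  admissible constant already forces the left side to be nonpositive.\<close>

lemma CF_bound: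
  fixes \<Omega> :: "'a::euclidean_space set"
  assumes p: "0 < p" and s: "0 < s" "s < 1" and \<Omega>: "open \<Omega>" "bounded \<Omega>"
  shows "0 \<le> CF p s \<Omega>"
    and "w \<in> W0 p s \<Omega> \<Longrightarrow> Lp_norm (lebesgue_on \<Omega>) p w \<le> CF p s \<Omega> * gagliardo p s w"
proof -
  let ?S = "{C. 0 \<le> C \<and> (\<forall>w\<in>W0 p s \<Omega>. Lp_norm (lebesgue_on \<Omega>) p w \<le> C * gagliardo p s w)}"
  obtain C where C: "C \<in> ?S" using fractional_Poincare[OF p s \<Omega>] by (elim exE) simp
  then have ne: "?S \<noteq> {}" by blast
  show "0 \<le> CF p s \<Omega>" unfolding CF_def by (rule cInf_greatest[OF ne]) auto
  assume w: "w \<in> W0 p s \<Omega>"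
  have g0: "0 \<le> gagliardo p s w" by (simp add: gagliardo_def)
  show "Lp_norm (lebesgue_on \<Omega>) p w \<le> CF p s \<Omega> * gagliardo p s w"
  proof (cases "gagliardo p s w = 0")
    case True
    then show ?thesis using bspec[OF conjunct2[OF C[unfolded mem_Collect_eq]] w] by simp
  next
    case False
    then have g: "0 < gagliardo p s w" using g0 by simp
    have "Lp_norm (lebesgue_on \<Omega>) p w / gagliardo p s w \<le> CF p s \<Omega>"
      unfolding CF_def
    proof (rule cInf_greatest[OF ne])
      fix C assume "C \<in> ?S"
      then have "Lp_norm (lebesgue_on \<Omega>) p w \<le> C * gagliardo p s w" using w by simp
      then show "Lp_norm (lebesgue_on \<Omega>) p w / gagliardo p s w \<le> C" using g by (simp add: divide_le_eq)
    qed
    then show ?thesis using g by (simp add: divide_le_eq)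
  qed
qed

text \<open>Justifies the division by the seminorm in the dual norm. Seminorm 0 forces
  \<open>w\<close> to vanish on \<Omega> by the Poincare inequality, and outside \<Omega> it
  vanishes anyway.\<close>

lemma gagliardo_pos:
  fixes \<Omega> :: "'a::euclidean_space set"
  assumes p: "0 < p" and s: "0 < s" "s < 1" and \<Omega>: "open \<Omega>" "bounded \<Omega>"
    and w: "w \<in> W0 p s \<Omega>" "\<not> (AE x in lebesgue. w x = 0)"
  shows "0 < gagliardo p s w"
proof (rule ccontr)
  assume "\<not> ?thesis"
  moreover have "0 \<le> gagliardo p s w" by (simp add: gagliardo_def)
  ultimately have "gagliardo p s w = 0" by simp
  then have "Lp_norm (lebesgue_on \<Omega>) p w \<le> 0" using CF_bound(2)[OF p s \<Omega> w(1)] by simp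
  then have "Lp_norm (lebesgue_on \<Omega>) p w = 0" using Lp_norm_nonneg[of "lebesgue_on \<Omega>" p w] by linarith
  then have "(LINT x|lebesgue_on \<Omega>. \<bar>w x\<bar> powr p) = 0" using Lp_norm_powr[of p "lebesgue_on \<Omega>" w] p by simp
  moreover have \<Omega>m: "\<Omega> \<in> sets lebesgue" using \<Omega>(1) by auto
  then have int: "integrable (lebesgue_on \<Omega>) (\<lambda>x. \<bar>w x\<bar> powr p)"
    by (intro in_Lp_integrable in_Lp_lebesgue_on W0_in_Lp(1)[OF w(1) p])
  ultimately have "AE x in lebesgue_on \<Omega>. \<bar>w x\<bar> powr p = 0"
    using integral_nonneg_eq_0_iff_AE[OF int] by simp
  then have "AE x in lebesgue. x \<in> \<Omega> \<longrightarrow> \<bar>w x\<bar> powr p = 0"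
    using \<Omega>m by (simp add: AE_restrict_space_iff)
  with W0_eq_0_outside[OF p s \<Omega>(1) w(1)] have "AE x in lebesgue. w x = 0"
    by eventually_elim auto
  with w(2) show False by simp
qed

text \<open>Serves in contrapositive form: a function of positive seminorm is a competitor in the
  supremum defining the dual norm.\<close>

lemma AE_zero_gagliardo:
  fixes w :: "'a::euclidean_space \<Rightarrow> real"
  assumes "AE x in lebesgue. w x = 0" "0 < p"
  shows "gagliardo p s w = 0"
proof -
  have "AE z in lebesgue. \<bar>gag_quot p s w z\<bar> powr p = 0"
    using AE_lebesgue_fst[OF assms(1), where 'b = 'a] AE_lebesgue_snd[OF assms(1), where 'a = 'a]
    by eventually_elim (simp add: gag_quot_def case_prod_unfold)
  then have "(LINT z|lebesgue. \<bar>gag_quot p s w z\<bar> powr p) = 0" by (rule integral_eq_zero_AE)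
  then show ?thesis using assms(2) by (simp add: gagliardo_eq_Lp_norm Lp_norm_def)
qed

text \<open>Makes the index set of the dual norm nonempty, as is required for bounding a real
  supremum from above. A bump function is nonzero on a ball, which has positive measure.\<close>

lemma W0_nontrivial:
  fixes \<Omega> :: "'a::euclidean_space set"
  assumes p: "0 < p" and s: "0 < s" "s < 1" and \<Omega>: "open \<Omega>" "\<Omega> \<noteq> {}"
  obtains \<xi> where "\<xi> \<in> W0 p s \<Omega>" "\<not> (AE x in lebesgue. \<xi> x = 0)"
proof -
  obtain c where "c \<in> \<Omega>" using \<Omega>(2) by blast
  then obtain \<phi> r where \<phi>: "\<phi> \<in> test_functions \<Omega>" "0 < r" "\<And>x. x \<in> ball c r \<Longrightarrow> \<phi> x \<noteq> 0"
    using test_functions_bump[OF \<Omega>(1)] by blast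
  have "\<not> (AE x in lebesgue. \<phi> x = 0)"
  proof
    assume "AE x in lebesgue. \<phi> x = 0"
    then have "AE x in lebesgue. x \<notin> ball c r" by eventually_elim (use \<phi>(3) in auto)
    then have "emeasure lebesgue (ball c r) = 0"
      by (subst (asm) AE_iff_measurable[of "ball c r"]) auto
    then show False using \<phi>(2) unit_ball_vol_pos[of "real DIM('a)"] by (simp add: emeasure_ball)
  qed
  with test_functions_W0[OF p s \<phi>(1)] show thesis by (rule that)
qed

section \<open>The nonlocal divergence theorem\<close>

text \<open>The factor \<open>|x - y|^(- N / q)\<close> moves the weight of \<open>P_fun\<close> into the function.\<close>

definition dual_quot :: "real \<Rightarrow> ('a::euclidean_space \<times> 'a \<Rightarrow> real) \<Rightarrow> 'a \<times> 'a \<Rightarrow> real" where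
  "dual_quot q \<gamma> = (\<lambda>(x, y). \<gamma> (x, y) / norm (x - y) powr (real DIM('a) / q))"

lemma dual_quot_diff: "dual_quot q (\<lambda>z. f z - g z) z = dual_quot q f z - dual_quot q g z"
  by (cases z) (simp add: dual_quot_def diff_divide_distrib)

lemma P_integrand_eq: "0 < q \<Longrightarrow> P_integrand q \<gamma> z = \<bar>dual_quot q \<gamma> z\<bar> powr q"
  by (cases z) (simp add: P_integrand_def dual_quot_def powr_divide powr_powr)

lemma P_fun_eq_Lp_norm: "0 < q \<Longrightarrow> P_fun q \<gamma> powr (1 / q) = Lp_norm lebesgue q (dual_quot q \<gamma>)"
  by (simp add: P_fun_def Lp_norm_def P_integrand_eq)

lemma measurable_dual_quot:
  fixes \<gamma> :: "'a::euclidean_space \<times> 'a \<Rightarrow> real"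
  assumes "\<gamma> \<in> borel_measurable lebesgue"
  shows "dual_quot q \<gamma> \<in> borel_measurable lebesgue"
  using assms measurable_norm_diff_powr[where 'a = 'a]
  by (simp add: dual_quot_def case_prod_unfold)

lemma in_Lp_dual_quot:
  assumes "\<gamma> \<in> borel_measurable lebesgue" "integrable lebesgue (P_integrand q \<gamma>)" "0 < q"
  shows "in_Lp lebesgue q (dual_quot q \<gamma>)"
proof -
  have "P_integrand q \<gamma> = (\<lambda>z. \<bar>dual_quot q \<gamma> z\<bar> powr q)" using P_integrand_eq[OF assms(3)] by (rule ext)
  then show ?thesis using assms measurable_dual_quot[OF assms(1)] by (simp add: in_Lp_def)
qed

text \<open>The power map sends the weight exponent N/p to (N/p)(p-1) = N/q. Hence the flux of
  \<open>v\<close>, seen in the space where \<open>P_fun\<close> is a norm, is the very function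
  that is paired with \<open>gag_quot p s \<xi>\<close> in \<open>dF\<close>.\<close>

lemma dual_quot_frac_grad:
  fixes v :: "'a::euclidean_space \<Rightarrow> real"
  assumes "1 < p" "q = p / (p - 1)"
  shows "dual_quot q (\<lambda>z. sgn_powr p (frac_grad s v z)) z = sgn_powr p (gag_quot p s v z)"
proof (cases z)
  case (Pair x y)
  show ?thesis
  proof (cases "x = y")
    case False
    have e: "real DIM('a) / p * (p - 1) = real DIM('a) / q" using assms by simp
    have "gag_quot p s v z = frac_grad s v z / norm (x - y) powr (real DIM('a) / p)"
      by (simp add: Pair gag_quot_def frac_grad_def powr_add mult.commute)
    then have "sgn_powr p (gag_quot p s v z) = sgn_powr p (frac_grad s v z) / (norm (x - y) powr (real DIM('a) / p)) powr (p - 1)"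
      using False by (simp add: sgn_powr_divide_pos)
    then show ?thesis by (simp only: dual_quot_def Pair prod.case powr_powr e)
  qed (simp add: Pair dual_quot_def gag_quot_def frac_grad_def sgn_powr_def)
qed

text \<open>Conjugacy of the exponents: (N/p + s) + N/q = N + s, the exponent of the divergence
  kernel.\<close>

lemma gag_quot_mult_dual_quot:
  fixes \<xi> :: "'a::euclidean_space \<Rightarrow> real"
  assumes "1 < p" "q = p / (p - 1)"
  shows "gag_quot p s \<xi> (x, y) * dual_quot q \<gamma> (x, y) = (\<xi> x - \<xi> y) * frac_div_kernel s \<gamma> (x, y)"
proof -
  have "1 / p + 1 / q = 1" using assms by (simp add: add_divide_distrib[symmetric])
  then have "real DIM('a) * (1 / p + 1 / q) = real DIM('a)" by simp
  then have "(real DIM('a) / p + s) + real DIM('a) / q = real DIM('a) + s" by (simp add: distrib_left)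
  then have "norm (x - y) powr (real DIM('a) / p + s) * norm (x - y) powr (real DIM('a) / q) = norm (x - y) powr (real DIM('a) + s)"
    by (simp only: flip: powr_add)
  then show ?thesis by (simp add: gag_quot_def dual_quot_def frac_div_kernel_def)
qed

text \<open>Splitting the difference needs each half to converge absolutely. For the half with
  \<open>\<phi> (fst z)\<close> this is \<open>loc\<close> on the closed support of \<phi>, as
  \<phi> is bounded. Reflection and antisymmetry show that the other half is its negative; the
  resulting doubling is the factor 2 in \<open>frac_div\<close>.\<close>

lemma frac_div_by_parts_test:
  fixes \<gamma> :: "'a::euclidean_space \<times> 'a \<Rightarrow> real"
  assumes \<phi>: "\<phi> \<in> test_functions \<Omega>" and \<gamma>: "\<gamma> \<in> borel_measurable lebesgue"
    and anti: "\<And>x y. \<gamma> (x, y) = - \<gamma> (y, x)" and loc: "locally_convergent \<Omega> (frac_div_kernel s \<gamma>)"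
  shows "(LINT z|lebesgue. (\<phi> (fst z) - \<phi> (snd z)) * frac_div_kernel s \<gamma> z) = (LINT x|lebesgue. \<phi> x * frac_div s \<gamma> x)"
proof -
  let ?K = "closure {x. \<phi> x \<noteq> 0}"
  let ?k = "frac_div_kernel s \<gamma>"
  have K0: "\<phi> x = 0" if "x \<notin> ?K" for x
    using that set_mp[OF closure_subset, of x "{x. \<phi> x \<noteq> 0}"] by auto
  obtain M where M: "\<And>x. \<bar>\<phi> x\<bar> \<le> M" using test_functions_bounded[OF \<phi>] by blast
  have \<phi>m: "\<phi> \<in> borel_measurable lebesgue"
    by (intro measurable_completion) (simp add: borel_measurable_continuous_onI test_functions_continuous[OF \<phi>])
  have km: "?k \<in> borel_measurable lebesgue"
    using \<gamma> measurable_norm_diff_powr[where 'a = 'a] by (simp add: frac_div_kernel_def case_prod_unfold)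
  have "set_integrable lebesgue (?K \<times> UNIV) ?k"
    using loc test_functionsD(2,3)[OF \<phi>] by (simp add: locally_convergent_def)
  then have "integrable lebesgue (\<lambda>z. M * (indicator (?K \<times> UNIV) z * ?k z))"
    by (simp add: set_integrable_def)
  then have int: "integrable lebesgue (\<lambda>z. \<phi> (fst z) * ?k z)"
  proof (rule Bochner_Integration.integrable_bound)
    show "(\<lambda>z. \<phi> (fst z) * ?k z) \<in> borel_measurable lebesgue"
      using measurable_lebesgue_fst[OF \<phi>m, where 'b = 'a] km by measurable
    have "\<bar>\<phi> (fst z) * ?k z\<bar> \<le> \<bar>M * (indicator (?K \<times> UNIV) z * ?k z)\<bar>" for z
    proof (cases "fst z \<in> ?K")
      case True
      then have "indicator (?K \<times> UNIV) z = (1 :: real)" by (cases z) simp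
      moreover have "\<bar>\<phi> (fst z)\<bar> * \<bar>?k z\<bar> \<le> \<bar>M\<bar> * \<bar>?k z\<bar>"
        using M[of "fst z"] by (intro mult_right_mono) auto
      ultimately show ?thesis by (simp add: abs_mult)
    next
      case False
      then show ?thesis using K0[OF False] by simp
    qed
    then show "AE z in lebesgue. norm (\<phi> (fst z) * ?k z) \<le> norm (M * (indicator (?K \<times> UNIV) z * ?k z))" by simp
  qed
  have swap: "(\<lambda>(x, y). \<phi> (fst (y, x)) * ?k (y, x)) = (\<lambda>z. - (\<phi> (snd z) * ?k z))"
  proof (intro ext, clarify)
    fix x y
    show "\<phi> (fst (y, x)) * ?k (y, x) = - (\<phi> (snd (x, y)) * ?k (x, y))"
      using anti[of y x] by (simp add: frac_div_kernel_def norm_minus_commute[of y x])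
  qed
  have int': "integrable lebesgue (\<lambda>z. \<phi> (snd z) * ?k z)"
    and eq': "(LINT z|lebesgue. \<phi> (snd z) * ?k z) = - (LINT z|lebesgue. \<phi> (fst z) * ?k z)"
    using lebesgue_swap[OF int] unfolding swap by simp_all
  have "(LINT z|lebesgue. (\<phi> (fst z) - \<phi> (snd z)) * ?k z) = 2 * (LINT z|lebesgue. \<phi> (fst z) * ?k z)"
    using int int' eq' by (simp add: left_diff_distrib)
  also have "(LINT z|lebesgue. \<phi> (fst z) * ?k z) = (LINT x|lebesgue. LINT y|lebesgue. \<phi> x * ?k (x, y))"
    using lebesgue_Fubini(2)[OF int] by simp
  also have "2 * \<dots> = (LINT x|lebesgue. \<phi> x * frac_div s \<gamma> x)"
    by (simp add: frac_div_def mult.left_commute[of _ "2 :: real"])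
  finally show ?thesis .
qed

text \<open>Both sides are linear in \<xi>. By Hoelder's inequality the left one is controlled by
  the seminorm and the right one by the norm in L^p, and approximation in \<open>W0\<close> makes
  both small at once.\<close>

lemma frac_div_by_parts:
  fixes \<gamma> :: "'a::euclidean_space \<times> 'a \<Rightarrow> real"
  assumes p: "1 < p" and q: "q = p / (p - 1)" and s: "0 < s" "s < 1" and \<Omega>: "open \<Omega>"
    and \<gamma>: "\<gamma> \<in> Qs s \<Omega> q" and \<xi>: "\<xi> \<in> W0 p s \<Omega>"
  shows "(LINT z|lebesgue. gag_quot p s \<xi> z * dual_quot q \<gamma> z) = (LINT x|lebesgue_on \<Omega>. \<xi> x * frac_div s \<gamma> x)"
proof -
  have p0: "0 < p" and q0: "0 < q" using p q by auto
  have \<Omega>m: "\<Omega> \<in> sets lebesgue" using \<Omega> by auto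
  have \<gamma>m: "\<gamma> \<in> borel_measurable lebesgue" and anti: "\<And>x y. \<gamma> (x, y) = - \<gamma> (y, x)"
    and loc: "locally_convergent \<Omega> (frac_div_kernel s \<gamma>)" and divL: "in_Lp (lebesgue_on \<Omega>) q (frac_div s \<gamma>)"
    and Pint: "integrable lebesgue (P_integrand q \<gamma>)"
    using \<gamma> unfolding Qs_def frac_div_in_Lp_def by blast+
  note \<gamma>L = in_Lp_dual_quot[OF \<gamma>m Pint q0]
  define A where "A w = (LINT z|lebesgue. gag_quot p s w z * dual_quot q \<gamma> z)" for w
  define B where "B w = (LINT x|lebesgue_on \<Omega>. w x * frac_div s \<gamma> x)" for w
  have AB: "A \<phi> = B \<phi>" if \<phi>: "\<phi> \<in> test_functions \<Omega>" for \<phi>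
  proof -
    have \<phi>0: "\<phi> x = 0" if "x \<notin> \<Omega>" for x
      using that test_functionsD(3)[OF \<phi>] set_mp[OF closure_subset, of x "{x. \<phi> x \<noteq> 0}"] by auto
    have "gag_quot p s \<phi> z * dual_quot q \<gamma> z = (\<phi> (fst z) - \<phi> (snd z)) * frac_div_kernel s \<gamma> z" for z
      by (cases z) (simp only: gag_quot_mult_dual_quot[OF p q] fst_conv snd_conv)
    then have "A \<phi> = (LINT x|lebesgue. \<phi> x * frac_div s \<gamma> x)"
      unfolding A_def using frac_div_by_parts_test[OF \<phi> \<gamma>m anti loc] by (simp only:)
    also have "\<dots> = B \<phi>" unfolding B_def integral_lebesgue_on_eq(1)[OF \<Omega>m]
      by (intro Bochner_Integration.integral_cong) (auto simp: indicator_def \<phi>0)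
    finally show ?thesis .
  qed
  define N where "N = Lp_norm lebesgue q (dual_quot q \<gamma>) + Lp_norm (lebesgue_on \<Omega>) q (frac_div s \<gamma>)"
  have le: "\<bar>A \<xi> - B \<xi>\<bar> \<le> \<epsilon> * N" if \<epsilon>: "0 < \<epsilon>" for \<epsilon>
  proof -
    obtain \<phi> where \<phi>: "\<phi> \<in> test_functions \<Omega>" "Lp_norm lebesgue p (\<lambda>x. \<xi> x - \<phi> x) < \<epsilon>"
      "Lp_norm lebesgue p (\<lambda>z. gag_quot p s \<xi> z - gag_quot p s \<phi> z) < \<epsilon>"
      using W0_approx[OF \<xi> p0 \<epsilon>] .
    note \<xi>L = W0_in_Lp[OF \<xi> p0] and \<phi>L = W0_in_Lp[OF test_functions_W0[OF p0 s \<phi>(1)] p0]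
    have "A \<xi> - A \<phi> = (LINT z|lebesgue. (gag_quot p s \<xi> z - gag_quot p s \<phi> z) * dual_quot q \<gamma> z)"
      unfolding A_def using Holder(1)[OF \<xi>L(2) \<gamma>L p q] Holder(1)[OF \<phi>L(2) \<gamma>L p q] by (simp add: left_diff_distrib)
    then have "\<bar>A \<xi> - A \<phi>\<bar> \<le> Lp_norm lebesgue p (\<lambda>z. gag_quot p s \<xi> z - gag_quot p s \<phi> z) * Lp_norm lebesgue q (dual_quot q \<gamma>)"
      using Holder(2)[OF in_Lp_diff[OF \<xi>L(2) \<phi>L(2) p0] \<gamma>L p q] by simp
    also have "\<dots> \<le> \<epsilon> * Lp_norm lebesgue q (dual_quot q \<gamma>)"
      using \<phi>(3) by (intro mult_right_mono Lp_norm_nonneg) simp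
    finally have 1: "\<bar>A \<xi> - A \<phi>\<bar> \<le> \<epsilon> * Lp_norm lebesgue q (dual_quot q \<gamma>)" .
    note \<xi>L' = in_Lp_lebesgue_on[OF \<xi>L(1) \<Omega>m] and \<phi>L' = in_Lp_lebesgue_on[OF \<phi>L(1) \<Omega>m]
    have "B \<xi> - B \<phi> = (LINT x|lebesgue_on \<Omega>. (\<xi> x - \<phi> x) * frac_div s \<gamma> x)"
      unfolding B_def using Holder(1)[OF \<xi>L' divL p q] Holder(1)[OF \<phi>L' divL p q] by (simp add: left_diff_distrib)
    then have "\<bar>B \<xi> - B \<phi>\<bar> \<le> Lp_norm (lebesgue_on \<Omega>) p (\<lambda>x. \<xi> x - \<phi> x) * Lp_norm (lebesgue_on \<Omega>) q (frac_div s \<gamma>)"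
      using Holder(2)[OF in_Lp_diff[OF \<xi>L' \<phi>L' p0] divL p q] by simp
    also have "\<dots> \<le> \<epsilon> * Lp_norm (lebesgue_on \<Omega>) q (frac_div s \<gamma>)"
      using \<phi>(2) Lp_norm_lebesgue_on_le[OF in_Lp_diff[OF \<xi>L(1) \<phi>L(1) p0] \<Omega>m p0]
      by (intro mult_right_mono Lp_norm_nonneg) simp
    finally have 2: "\<bar>B \<xi> - B \<phi>\<bar> \<le> \<epsilon> * Lp_norm (lebesgue_on \<Omega>) q (frac_div s \<gamma>)" .
    show ?thesis using 1 2 AB[OF \<phi>(1)] by (simp add: N_def distrib_left)
  qed
  have N0: "0 \<le> N" by (simp add: N_def Lp_norm_nonneg)
  have "A \<xi> = B \<xi>"
  proof (rule ccontr)
    assume "A \<xi> \<noteq> B \<xi>"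
    then have pos: "0 < \<bar>A \<xi> - B \<xi>\<bar>" by simp
    \<comment> \<open>\<open>N\<close> may be 0, so a positive upper bound is taken instead to form
      the admissible \<epsilon> = |A \<xi> - B \<xi>| / (2 M).\<close>
    obtain M where M: "0 < M" "N \<le> M" using gt_ex[of N] N0 by (meson le_less_trans less_imp_le)
    have "\<bar>A \<xi> - B \<xi>\<bar> \<le> \<bar>A \<xi> - B \<xi>\<bar> / 2 / M * N" using pos M by (intro le) simp
    also have "\<dots> \<le> \<bar>A \<xi> - B \<xi>\<bar> / 2 / M * M" using M by (intro mult_left_mono) auto
    also have "\<dots> = \<bar>A \<xi> - B \<xi>\<bar> / 2" using M by simp
    finally show False using pos by simp
  qed
  then show ?thesis by (simp add: A_def B_def)
qed

text \<open>The seminorm stands as a factor rather than as a denominator, so that no positivity of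
  it is involved yet.\<close>

lemma dF_le_Qs:
  fixes \<gamma> :: "'a::euclidean_space \<times> 'a \<Rightarrow> real"
  assumes p: "1 < p" and q: "q = p / (p - 1)" and s: "0 < s" "s < 1" and \<Omega>: "open \<Omega>" "bounded \<Omega>"
    and h: "in_Lp (lebesgue_on \<Omega>) q h" and \<gamma>: "\<gamma> \<in> Qs s \<Omega> q" and v: "v \<in> W0 p s \<Omega>" and \<xi>: "\<xi> \<in> W0 p s \<Omega>"
  shows "dF p s \<Omega> h v \<xi> \<le>
    (P_fun q (\<lambda>z. sgn_powr p (frac_grad s v z) - \<gamma> z) powr (1 / q)
      + CF p s \<Omega> * Lp_norm (lebesgue_on \<Omega>) q (\<lambda>x. frac_div s \<gamma> x - h x)) * gagliardo p s \<xi>"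
proof -
  have p0: "0 < p" and q0: "0 < q" using p q by auto
  have \<Omega>m: "\<Omega> \<in> sets lebesgue" using \<Omega> by auto
  have divL: "in_Lp (lebesgue_on \<Omega>) q (frac_div s \<gamma>)" and \<gamma>L: "in_Lp lebesgue q (dual_quot q \<gamma>)"
    using \<gamma> in_Lp_dual_quot[OF _ _ q0] unfolding Qs_def frac_div_in_Lp_def by blast+
  note \<xi>L = W0_in_Lp[OF \<xi> p0]
  note \<xi>L' = in_Lp_lebesgue_on[OF \<xi>L(1) \<Omega>m]
  note vL = in_Lp_sgn_powr[OF W0_in_Lp(2)[OF v p0] p q]
  define E where "E z = sgn_powr p (gag_quot p s v z) - dual_quot q \<gamma> z" for z
  have EL: "in_Lp lebesgue q E" unfolding E_def by (rule in_Lp_diff[OF vL \<gamma>L q0])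
  have E: "dual_quot q (\<lambda>z. sgn_powr p (frac_grad s v z) - \<gamma> z) = E"
    by (simp only: E_def fun_eq_iff dual_quot_diff dual_quot_frac_grad[OF p q] simp_thms)
  have "(LINT z|lebesgue. sgn_powr p (gag_quot p s v z) * gag_quot p s \<xi> z)
      = (LINT z|lebesgue. gag_quot p s \<xi> z * E z + gag_quot p s \<xi> z * dual_quot q \<gamma> z)"
    by (simp add: E_def algebra_simps)
  also have "\<dots> = (LINT z|lebesgue. gag_quot p s \<xi> z * E z) + (LINT x|lebesgue_on \<Omega>. \<xi> x * frac_div s \<gamma> x)"
    using Holder(1)[OF \<xi>L(2) EL p q] Holder(1)[OF \<xi>L(2) \<gamma>L p q] frac_div_by_parts[OF p q s \<Omega>(1) \<gamma> \<xi>] by simp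
  finally have "dF p s \<Omega> h v \<xi> = (LINT z|lebesgue. gag_quot p s \<xi> z * E z)
      + (LINT x|lebesgue_on \<Omega>. \<xi> x * (frac_div s \<gamma> x - h x))"
    unfolding dF_eq[OF p0] using Holder(1)[OF \<xi>L' divL p q] Holder(1)[OF \<xi>L' h p q]
    by (simp add: right_diff_distrib mult.commute[of "h _"])
  also have "\<dots> \<le> Lp_norm lebesgue p (gag_quot p s \<xi>) * Lp_norm lebesgue q E
      + Lp_norm (lebesgue_on \<Omega>) p \<xi> * Lp_norm (lebesgue_on \<Omega>) q (\<lambda>x. frac_div s \<gamma> x - h x)"
    using Holder(2)[OF \<xi>L(2) EL p q] Holder(2)[OF \<xi>L' in_Lp_diff[OF divL h q0] p q] by linarith
  also have "\<dots> \<le> gagliardo p s \<xi> * P_fun q (\<lambda>z. sgn_powr p (frac_grad s v z) - \<gamma> z) powr (1 / q)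
      + CF p s \<Omega> * gagliardo p s \<xi> * Lp_norm (lebesgue_on \<Omega>) q (\<lambda>x. frac_div s \<gamma> x - h x)"
    unfolding P_fun_eq_Lp_norm[OF q0] E gagliardo_eq_Lp_norm[OF p0, symmetric]
    by (intro add_mono order_refl mult_right_mono CF_bound(2)[OF p0 s \<Omega> \<xi>] Lp_norm_nonneg)
  finally show ?thesis by (simp add: algebra_simps)
qed

text \<open>Has two uses: the infimum in the second estimate runs over a nonempty set, and gamma = 0
  gives the upper bound that makes the dual norm a genuine supremum.\<close>

lemma zero_in_Qs: "0 < q \<Longrightarrow> (\<lambda>z. 0) \<in> Qs s \<Omega> q"
  by (auto simp: Qs_def frac_div_in_Lp_def locally_convergent_def in_Lp_def frac_div_kernel_def[abs_def]
      frac_div_def[abs_def] P_integrand_def[abs_def] case_prod_unfold set_integrable_def)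

section \<open>The dual norm of the residual\<close>

text \<open>The kernels coincide since s(p-1) + (N + s) = N + ps, so local convergence and
  integrability of the divergence transfer directly. Finiteness of \<open>P_integrand\<close> comes
  from the finite seminorm of \<open>v\<close>.\<close>

lemma frac_plap_in_Qs:
  assumes p: "1 < p" and q: "q = p / (p - 1)" and v: "v \<in> W0 p s \<Omega>" and plap: "frac_plap_in_Lp p s \<Omega> q v"
  shows "(\<lambda>z. sgn_powr p (frac_grad s v z)) \<in> Qs s \<Omega> q"
    and "frac_div s (\<lambda>z. sgn_powr p (frac_grad s v z)) = frac_plap p s v"
proof -
  have p0: "0 < p" and q0: "0 < q" using p q by auto
  let ?\<gamma> = "\<lambda>z. sgn_powr p (frac_grad s v z)"
  have vm: "v \<in> borel_measurable lebesgue" using W0_in_Lp(1)[OF v p0] by (simp add: in_Lp_def)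
  \<comment> \<open>Shifting the order to s - N/p cancels the N/p in the weight, so measurability of
    \<open>gag_quot\<close> can be reused.\<close>
  have "frac_grad s v = gag_quot p (s - real DIM('a) / p) v"
    by (simp add: frac_grad_def gag_quot_def)
  then have "frac_grad s v \<in> borel_measurable lebesgue" using measurable_gag_quot[OF vm] by simp
  then have m: "?\<gamma> \<in> borel_measurable lebesgue" by measurable
  have anti: "?\<gamma> (x, y) = - ?\<gamma> (y, x)" for x y
    using sgn_powr_minus[of p "frac_grad s v (y, x)"]
    by (simp add: frac_grad_def norm_minus_commute[of y x] minus_divide_left)
  have "frac_div_kernel s ?\<gamma> (x, y) = frac_plap_kernel p s v (x, y)" for x y
  proof (cases "x = y")
    case False
    have "s * (p - 1) + (real DIM('a) + s) = real DIM('a) + p * s" by (simp add: algebra_simps)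
    then have "norm (x - y) powr (s * (p - 1)) * norm (x - y) powr (real DIM('a) + s) = norm (x - y) powr (real DIM('a) + p * s)"
      by (simp only: flip: powr_add)
    then show ?thesis using False
      by (simp add: frac_div_kernel_def frac_plap_kernel_def frac_grad_def sgn_powr_divide_pos powr_powr)
  qed (simp add: frac_div_kernel_def frac_plap_kernel_def frac_grad_def sgn_powr_def)
  then have k: "frac_div_kernel s ?\<gamma> = frac_plap_kernel p s v" by (simp add: fun_eq_iff)
  show d: "frac_div s ?\<gamma> = frac_plap p s v"
    by (simp only: frac_div_def frac_plap_def fun_eq_iff k simp_thms)
  have "frac_div_in_Lp s \<Omega> q ?\<gamma>"
    using plap by (simp only: frac_div_in_Lp_def frac_plap_in_Lp_def k d)
  moreover have "integrable lebesgue (P_integrand q ?\<gamma>)"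
  proof -
    have "P_integrand q ?\<gamma> = (\<lambda>z. \<bar>sgn_powr p (gag_quot p s v z)\<bar> powr q)"
      by (simp only: fun_eq_iff P_integrand_eq[OF q0] dual_quot_frac_grad[OF p q] simp_thms)
    then show ?thesis using in_Lp_integrable[OF in_Lp_sgn_powr[OF W0_in_Lp(2)[OF v p0] p q]] by (simp only:)
  qed
  ultimately show "?\<gamma> \<in> Qs s \<Omega> q" unfolding Qs_def using m anti by blast
qed

lemma dF_ratio_le_Qs:
  fixes \<gamma> :: "'a::euclidean_space \<times> 'a \<Rightarrow> real"
  assumes p: "1 < p" and q: "q = p / (p - 1)" and s: "0 < s" "s < 1" and \<Omega>: "open \<Omega>" "bounded \<Omega>"
    and h: "in_Lp (lebesgue_on \<Omega>) q h" and \<gamma>: "\<gamma> \<in> Qs s \<Omega> q" and v: "v \<in> W0 p s \<Omega>"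
    and \<xi>: "\<xi> \<in> {\<xi> \<in> W0 p s \<Omega>. \<not> (AE x in lebesgue. \<xi> x = 0)}"
  shows "dF p s \<Omega> h v \<xi> / gagliardo p s \<xi> \<le>
    P_fun q (\<lambda>z. sgn_powr p (frac_grad s v z) - \<gamma> z) powr (1 / q)
      + CF p s \<Omega> * Lp_norm (lebesgue_on \<Omega>) q (\<lambda>x. frac_div s \<gamma> x - h x)"
proof -
  have "0 < gagliardo p s \<xi>" using p \<xi> by (intro gagliardo_pos[OF _ s \<Omega>]) auto
  moreover have "\<xi> \<in> W0 p s \<Omega>" using \<xi> by simp
  from dF_le_Qs[OF p q s \<Omega> h \<gamma> v this] have "dF p s \<Omega> h v \<xi> \<le>
    (P_fun q (\<lambda>z. sgn_powr p (frac_grad s v z) - \<gamma> z) powr (1 / q)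
      + CF p s \<Omega> * Lp_norm (lebesgue_on \<Omega>) q (\<lambda>x. frac_div s \<gamma> x - h x)) * gagliardo p s \<xi>" .
  ultimately show ?thesis by (simp add: pos_divide_le_eq)
qed

lemma dF_dual_norm_le_Qs:
  fixes \<gamma> :: "'a::euclidean_space \<times> 'a \<Rightarrow> real"
  assumes p: "1 < p" and q: "q = p / (p - 1)" and s: "0 < s" "s < 1" and \<Omega>: "open \<Omega>" "bounded \<Omega>" "\<Omega> \<noteq> {}"
    and h: "in_Lp (lebesgue_on \<Omega>) q h" and \<gamma>: "\<gamma> \<in> Qs s \<Omega> q" and v: "v \<in> W0 p s \<Omega>"
  shows "dF_dual_norm p s \<Omega> h v \<le> P_fun q (\<lambda>z. sgn_powr p (frac_grad s v z) - \<gamma> z) powr (1 / q)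
      + CF p s \<Omega> * Lp_norm (lebesgue_on \<Omega>) q (\<lambda>x. frac_div s \<gamma> x - h x)"
proof -
  have "0 < p" using p by simp
  then obtain \<xi> where "\<xi> \<in> W0 p s \<Omega>" "\<not> (AE x in lebesgue. \<xi> x = 0)"
    by (rule W0_nontrivial[OF _ s \<Omega>(1,3)])
  then have "{\<xi> \<in> W0 p s \<Omega>. \<not> (AE x in lebesgue. \<xi> x = 0)} \<noteq> {}" by blast
  then show ?thesis unfolding dF_dual_norm_def
    by (rule cSUP_least) (rule dF_ratio_le_Qs[OF p q s \<Omega>(1,2) h \<gamma> v])
qed

text \<open>A real supremum dominates its members only when they are bounded above; the bound for
  the ratios is the estimate with gamma = 0.\<close>

lemma dF_le_dual_norm:
  fixes \<Omega> :: "'a::euclidean_space set"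
  assumes p: "1 < p" and q: "q = p / (p - 1)" and s: "0 < s" "s < 1" and \<Omega>: "open \<Omega>" "bounded \<Omega>"
    and h: "in_Lp (lebesgue_on \<Omega>) q h" and v: "v \<in> W0 p s \<Omega>"
    and \<xi>: "\<xi> \<in> W0 p s \<Omega>" "0 < gagliardo p s \<xi>"
  shows "dF p s \<Omega> h v \<xi> \<le> dF_dual_norm p s \<Omega> h v * gagliardo p s \<xi>"
proof -
  let ?S = "{\<xi> \<in> W0 p s \<Omega>. \<not> (AE x in lebesgue. \<xi> x = 0)}"
  have q0: "0 < q" using p q by simp
  have "bdd_above ((\<lambda>\<xi>. dF p s \<Omega> h v \<xi> / gagliardo p s \<xi>) ` ?S)"
    by (rule bdd_aboveI2) (rule dF_ratio_le_Qs[OF p q s \<Omega> h zero_in_Qs[OF q0] v])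
  moreover have "\<xi> \<in> ?S" using \<xi> AE_zero_gagliardo[of \<xi> p s] p by auto
  ultimately have "dF p s \<Omega> h v \<xi> / gagliardo p s \<xi> \<le> dF_dual_norm p s \<Omega> h v"
    unfolding dF_dual_norm_def by (intro cSUP_upper)
  then show ?thesis using \<xi>(2) by (simp add: pos_divide_le_eq)
qed

text \<open>The integrals of \<open>h\<close> against v - u cancel in the difference. The test
  function is v - u and not u - v so that, for a solution \<open>u\<close>, what remains is
  \<open>dF\<close> at \<open>v\<close> with a positive sign.\<close>

lemma integral_sgn_powr_diff_eq_dF:
  fixes \<Omega> :: "'a::euclidean_space set"
  assumes p: "1 < p" and q: "q = p / (p - 1)"
    and u: "u \<in> W0 p s \<Omega>" and v: "v \<in> W0 p s \<Omega>"
  shows "(LINT z|lebesgue. (sgn_powr p (gag_quot p s u z) - sgn_powr p (gag_quot p s v z)) * (gag_quot p s u z - gag_quot p s v z))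
    = dF p s \<Omega> h v (\<lambda>x. v x - u x) - dF p s \<Omega> h u (\<lambda>x. v x - u x)"
proof -
  have p0: "0 < p" using p by simp
  note uL = W0_in_Lp(2)[OF u p0] and vL = W0_in_Lp(2)[OF v p0]
  note dL = in_Lp_diff[OF vL uL p0]
  have "(LINT z|lebesgue. (sgn_powr p (gag_quot p s u z) - sgn_powr p (gag_quot p s v z)) * (gag_quot p s u z - gag_quot p s v z))
    = (LINT z|lebesgue. (gag_quot p s v z - gag_quot p s u z) * sgn_powr p (gag_quot p s v z)
        - (gag_quot p s v z - gag_quot p s u z) * sgn_powr p (gag_quot p s u z))"
    by (intro Bochner_Integration.integral_cong refl) (simp add: algebra_simps)
  also have "\<dots> = (LINT z|lebesgue. (gag_quot p s v z - gag_quot p s u z) * sgn_powr p (gag_quot p s v z))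
      - (LINT z|lebesgue. (gag_quot p s v z - gag_quot p s u z) * sgn_powr p (gag_quot p s u z))"
    by (intro Bochner_Integration.integral_diff Holder(1)[OF dL in_Lp_sgn_powr[OF vL p q] p q] Holder(1)[OF dL in_Lp_sgn_powr[OF uL p q] p q])
  also have "\<dots> = dF p s \<Omega> h v (\<lambda>x. v x - u x) - dF p s \<Omega> h u (\<lambda>x. v x - u x)"
    by (simp add: dF_eq[OF p0] gag_quot_diff mult.commute)
  finally show ?thesis .
qed

text \<open>Testing with \<open>u\<close> gives [u]^p = \<integral> h u <= CF [u] |h|_q by the
  Hoelder and Poincare inequalities. Dividing by [u] and raising to the power q gives the claim,
  because (p-1) q = p.\<close>

lemma gagliardo_solution_bound:
  fixes \<Omega> :: "'a::euclidean_space set"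
  assumes p: "1 < p" and q: "q = p / (p - 1)" and s: "0 < s" "s < 1" and \<Omega>: "open \<Omega>" "bounded \<Omega>"
    and h: "in_Lp (lebesgue_on \<Omega>) q h" and u: "u \<in> W0 p s \<Omega>" "dF p s \<Omega> h u u = 0"
  shows "gagliardo p s u powr p \<le> CF p s \<Omega> powr q * Lp_norm (lebesgue_on \<Omega>) q h powr q"
proof (cases "gagliardo p s u = 0")
  case True
  then show ?thesis by simp
next
  case False
  have p0: "0 < p" using p by simp
  have \<Omega>m: "\<Omega> \<in> sets lebesgue" using \<Omega> by auto
  have g: "0 < gagliardo p s u" using False by (simp add: gagliardo_def less_le)
  have "gagliardo p s u powr p = (LINT z|lebesgue. sgn_powr p (gag_quot p s u z) * gag_quot p s u z)"
    using p0 by (simp add: gagliardo_eq_Lp_norm Lp_norm_powr sgn_powr_mult_self)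
  also have "\<dots> = (LINT x|lebesgue_on \<Omega>. u x * h x)" using u(2) by (simp add: dF_eq[OF p0] mult.commute)
  also have "\<dots> \<le> Lp_norm (lebesgue_on \<Omega>) p u * Lp_norm (lebesgue_on \<Omega>) q h"
    using Holder(2)[OF in_Lp_lebesgue_on[OF W0_in_Lp(1)[OF u(1) p0] \<Omega>m] h p q] by linarith
  also have "\<dots> \<le> CF p s \<Omega> * gagliardo p s u * Lp_norm (lebesgue_on \<Omega>) q h"
    by (intro mult_right_mono CF_bound(2)[OF p0 s \<Omega> u(1)] Lp_norm_nonneg)
  finally have "gagliardo p s u powr (p - 1) * gagliardo p s u \<le> CF p s \<Omega> * Lp_norm (lebesgue_on \<Omega>) q h * gagliardo p s u"
    using g by (simp add: powr_diff mult.commute mult.left_commute)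
  then have "gagliardo p s u powr (p - 1) \<le> CF p s \<Omega> * Lp_norm (lebesgue_on \<Omega>) q h"
    using g by (simp add: mult_le_cancel_right)
  then have "(gagliardo p s u powr (p - 1)) powr q \<le> (CF p s \<Omega> * Lp_norm (lebesgue_on \<Omega>) q h) powr q"
    using p q by (intro powr_mono2) auto
  then show ?thesis using p q by (simp add: powr_powr powr_mult)
qed

lemma gagliardo_minus_commute: "gagliardo p s (\<lambda>x. u x - v x) = gagliardo p s (\<lambda>x. v x - u x)"
proof -
  have "gagliardo_integrand p s (\<lambda>x. u x - v x) = gagliardo_integrand p s (\<lambda>x. v x - u x)"
    by (simp add: gagliardo_integrand_def fun_eq_iff) (simp add: abs_minus_commute algebra_simps)
  then show ?thesis by (simp add: gagliardo_def)
qed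

theorem theorem7p1:
  fixes p p' s C :: real
    and \<Omega> :: "'a::euclidean_space set"
    and h u v :: "'a \<Rightarrow> real"
  assumes p: "1 < p" and p': "p' = p / (p - 1)"
    and s: "0 < s" "s < 1"
    and \<Omega>: "open \<Omega>" "bounded \<Omega>"
    and h: "in_Lp (lebesgue_on \<Omega>) p' h" "\<not> (AE x in lebesgue_on \<Omega>. h x = 0)"
    and u: "u \<in> W0 p s \<Omega>" "\<forall>\<xi>\<in>W0 p s \<Omega>. dF p s \<Omega> h u \<xi> = 0"
    and v: "v \<in> W0 p s \<Omega>"
    and C: "C = (if 2 \<le> p then 2 powr ((p - 2) / (p - 1))
                 else inverse (p - 1) * 2 powr ((2 - p) / p) *
                   (CF p s \<Omega> powr p' * Lp_norm (lebesgue_on \<Omega>) p' h powr p' + gagliardo p s v powr p)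
                     powr ((2 - p) / p))"
  shows "gagliardo p s (\<lambda>x. u x - v x) \<le> C * dF_dual_norm p s \<Omega> h v powr (1 / max 1 (p - 1))
    \<and> dF_dual_norm p s \<Omega> h v \<le>
        (INF \<gamma>\<in>Qs s \<Omega> p'.
           P_fun p' (\<lambda>z. sgn_powr p (frac_grad s v z) - \<gamma> z) powr (1 / p')
           + CF p s \<Omega> * Lp_norm (lebesgue_on \<Omega>) p' (\<lambda>x. frac_div s \<gamma> x - h x))
    \<and> (frac_plap_in_Lp p s \<Omega> p' v \<longrightarrow>
        dF_dual_norm p s \<Omega> h v \<le> CF p s \<Omega> * Lp_norm (lebesgue_on \<Omega>) p' (\<lambda>x. frac_plap p s v x - h x))"
proof (intro conjI impI)
  have p0: "0 < p" and p'0: "0 < p'" using p p' by auto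
  \<comment> \<open>On an empty set \<open>h\<close> would vanish almost everywhere; nonemptiness is
    what supplies a competitor for the dual norm.\<close>
  have ne: "\<Omega> \<noteq> {}"
  proof
    assume "\<Omega> = {}"
    then have "AE x in lebesgue_on \<Omega>. h x = 0" by (intro AE_I2) (simp add: space_restrict_space)
    with h(2) show False by simp
  qed
  note le_Qs = dF_dual_norm_le_Qs[OF p p' s \<Omega> ne h(1) _ v]
  have "Qs s \<Omega> p' \<noteq> {}" using zero_in_Qs[OF p'0] by blast
  then show "dF_dual_norm p s \<Omega> h v \<le>
        (INF \<gamma>\<in>Qs s \<Omega> p'.
           P_fun p' (\<lambda>z. sgn_powr p (frac_grad s v z) - \<gamma> z) powr (1 / p')
           + CF p s \<Omega> * Lp_norm (lebesgue_on \<Omega>) p' (\<lambda>x. frac_div s \<gamma> x - h x))"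
    by (rule cINF_greatest) (rule le_Qs)
  show "dF_dual_norm p s \<Omega> h v \<le> CF p s \<Omega> * Lp_norm (lebesgue_on \<Omega>) p' (\<lambda>x. frac_plap p s v x - h x)"
    if "frac_plap_in_Lp p s \<Omega> p' v"
    \<comment> \<open>With this choice the \<open>P_fun\<close> term is the integral of 0 raised to
      a power, hence 0.\<close>
    using le_Qs[OF frac_plap_in_Qs(1)[OF p p' v that]] unfolding frac_plap_in_Qs(2)[OF p p' v that]
    by (simp add: P_fun_def P_integrand_def case_prod_unfold)
  define g where "g = gagliardo p s (\<lambda>x. u x - v x)"
  define D where "D = dF_dual_norm p s \<Omega> h v"
  define I where "I = (LINT z|lebesgue. (sgn_powr p (gag_quot p s u z) - sgn_powr p (gag_quot p s v z)) * (gag_quot p s u z - gag_quot p s v z))"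
  have g_eq: "g = Lp_norm lebesgue p (\<lambda>z. gag_quot p s u z - gag_quot p s v z)"
    unfolding g_def gagliardo_eq_Lp_norm[OF p0] by (simp only: gag_quot_diff[abs_def])
  have g0: "0 \<le> g" by (simp add: g_eq Lp_norm_nonneg)
  note uL = W0_in_Lp(2)[OF u(1) p0] and vL = W0_in_Lp(2)[OF v p0]
  have "g \<le> C * D powr (1 / max 1 (p - 1))"
  proof (cases "g = 0")
    \<comment> \<open>Kept apart because the main estimate is divided by \<open>g\<close>, and
      because v - u is a competitor in the dual norm only if its seminorm is positive.\<close>
    case True
    have "0 \<le> C" using p by (simp add: C)
    with True show ?thesis by simp
  next
    case False
    then have g: "0 < g" using g0 by simp
    have d: "(\<lambda>x. v x - u x) \<in> W0 p s \<Omega>" by (rule W0_diff[OF less_imp_le[OF p] s v u(1)])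
    have gd: "g = gagliardo p s (\<lambda>x. v x - u x)" unfolding g_def by (rule gagliardo_minus_commute)
    have "dF p s \<Omega> h v (\<lambda>x. v x - u x) \<le> D * g"
      unfolding D_def gd by (rule dF_le_dual_norm[OF p p' s \<Omega> h(1) v d]) (use g gd in simp)
    then have I: "I \<le> D * g"
      unfolding I_def integral_sgn_powr_diff_eq_dF[OF p p' u(1) v, of h] using u(2) d by simp
    show ?thesis
    proof (cases "2 \<le> p")
      case True
      \<comment> \<open>After division by \<open>g\<close>, moving \<open>2 powr (2 - p)\<close> to
        the right and taking the root of order p - 1 produces both the constant 2^((p-2)/(p-1)) and
        the exponent 1/(p-1).\<close>
      have "2 powr (2 - p) * g powr p \<le> D * g"
        using Lp_norm_sgn_powr_diff_ge2[OF uL vL True] I by (simp add: g_eq I_def)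
      then have "2 powr (2 - p) * g powr (p - 1) \<le> D"
        using g by (simp add: powr_diff field_simps)
      then have "2 powr (p - 2) * (2 powr (2 - p) * g powr (p - 1)) \<le> 2 powr (p - 2) * D"
        by (intro mult_left_mono) auto
      moreover have "2 powr (p - 2) * (2 powr (2 - p) * g powr (p - 1)) = g powr (p - 1)"
        unfolding mult.assoc[symmetric] powr_add[symmetric] by simp
      ultimately have "g powr (p - 1) \<le> 2 powr (p - 2) * D" by simp
      then have "(g powr (p - 1)) powr (1 / (p - 1)) \<le> (2 powr (p - 2) * D) powr (1 / (p - 1))"
        using p by (intro powr_mono2) auto
      then have "g \<le> 2 powr ((p - 2) / (p - 1)) * D powr (1 / (p - 1))"
        using p g by (simp add: powr_powr powr_mult)
      then show ?thesis using True by (simp add: C max_def)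
    next
      case False
      then have p2: "p < 2" by simp
      define e where "e = (2 - p) / p"
      have e: "0 \<le> e" using p2 p0 by (simp add: e_def)
      \<comment> \<open>\<open>S\<close> is what the integrated monotonicity inequality yields;
        \<open>T\<close> bounds it with [u]^p replaced by the data.\<close>
      define S where "S = gagliardo p s u powr p + gagliardo p s v powr p"
      define T where "T = CF p s \<Omega> powr p' * Lp_norm (lebesgue_on \<Omega>) p' h powr p' + gagliardo p s v powr p"
      have ST: "0 \<le> S" "S \<le> T"
        using gagliardo_solution_bound[OF p p' s \<Omega> h(1) u(1)] u by (auto simp: S_def T_def)
      have 1: "(p - 1) * g\<^sup>2 \<le> I * S powr e"
        using Lp_norm_sgn_powr_diff_lt2[OF uL vL p p2]
        by (simp add: g_eq I_def S_def e_def gagliardo_eq_Lp_norm[OF p0])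
      have "0 < (p - 1) * g\<^sup>2" using p g by simp
      with 1 have "0 < I * S powr e" by simp
      then have "0 < I" by (simp add: zero_less_mult_iff)
      \<comment> \<open>As a supremum \<open>D\<close> has no evident sign, while
        \<open>D powr 1 = D\<close> is wanted at the end. Its positivity follows from 0 < I <= D
        g.\<close>
      then have D: "0 < D" using I g by (smt (verit) zero_less_mult_pos2)
      have "I * S powr e \<le> D * g * T powr e"
        using I D g e ST by (intro mult_mono powr_mono2) auto
      \<comment> \<open>The factor \<open>2 powr e\<close> of \<open>C\<close> enters here; it is at
        least 1 because \<open>e\<close> is nonnegative.\<close>
      also have "\<dots> \<le> D * g * (2 powr e * T powr e)"
        using D g mult_right_mono[of 1 "2 powr e" "T powr e"] e
        by (intro mult_left_mono) (auto simp: ge_one_powr_ge_zero)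
      finally have "(p - 1) * g * g \<le> D * (2 powr e * T powr e) * g"
        using 1 by (simp add: power2_eq_square mult.assoc mult.commute mult.left_commute)
      then have "(p - 1) * g \<le> D * (2 powr e * T powr e)" using g by simp
      then have "g \<le> inverse (p - 1) * 2 powr e * T powr e * D" using p by (simp add: field_simps)
      moreover have "C = inverse (p - 1) * 2 powr e * T powr e" using False by (simp add: C e_def T_def)
      moreover have "max 1 (p - 1) = 1" using p2 by simp
      ultimately show ?thesis using D by simp
    qed
  qed
  then show "gagliardo p s (\<lambda>x. u x - v x) \<le> C * dF_dual_norm p s \<Omega> h v powr (1 / max 1 (p - 1))"
    by (simp add: g_def D_def)
qed

end
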